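(* Let $f:\mathbb{R}^{m\times n}\to\mathbb{R}$ be $L$-smooth and $\mu$-strongly convex with minimizer $X^\star$ of rank at least $r$, and let $X_r^\star$ be the best rank-$r$ approximation of $X^\star$. Let $\kappa=\frac{\max\{L,L_g\}}{\min\{\mu,\mu_g\}}$, where $0<\mu_g\le L_g$ are the strong convexity and smoothness parameters of the regularizer $g$. If $$\|X^\star-X_r^\star\|_F\le\frac{\sigma_r(X^\star)}{100\sqrt\kappa},\qquad\kappa\le1+\frac{\sigma_r(X_r^\star)^2}{4608\,\|X_r^\star\|_F^2},$$ then the initial solution $$U_0=A_0\Sigma_0^{1/2},\qquad V_0=B_0\Sigma_0^{1/2},$$ where $A_0\Sigma_0B_0^\top$ is the rank-$r$ truncated SVD of $-\frac1L\nabla f(0)$ (with $A_0\in\mathbb{R}^{m\times r}$, $\Sigma_0\in\mathbb{R}^{r\times r}$, $B_0\in\mathbb{R}^{n\times r}$), satisfies $$\mathrm{Dist}(U_0,V_0;X_r^\star)\le\frac{\sqrt2\,\sigma_r(X_r^\star)^{1/2}}{10\sqrt\kappa}.$$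
   Context: $\|\cdot\|_F$ is the Frobenius norm and $\sigma_i(\cdot)$ the $i$-th largest singular value. A convex differentiable $f$ is $L$-smooth if $\|\nabla f(X)-\nabla f(Y)\|_F\le L\|X-Y\|_F$ for all $X,Y$, and $\mu$-strongly convex if $f(Y)\ge f(X)+\langle\nabla f(X),Y-X\rangle+\frac\mu2\|Y-X\|_F^2$ for all $X,Y$. The regularizer $g:\mathbb{R}^{r\times r}\to\mathbb{R}$ is an auxiliary $\mu_g$-strongly convex and $L_g$-smooth function; it enters only through $\mu_g,L_g$ in the definition of $\kappa$. $\mathcal{X}_r^\star=\{(U^\star,V^\star): U^\star\in\mathbb{R}^{m\times r},V^\star\in\mathbb{R}^{n\times r},\ U^\star V^{\star\top}=X_r^\star,\ \sigma_i(U^\star)=\sigma_i(V^\star)=\sigma_i(X_r^\star)^{1/2}\ \forall i\in[r]\}$, and $\mathrm{Dist}(U,V;X_r^\star)=\min_{(U^\star,V^\star)\in\mathcal{X}_r^\star}\left\|\begin{bmatrix}U \\ V\end{bmatrix}-\begin{bmatrix}U^\star \\ V^\star\end{bmatrix}\right\|_F$. *)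

theory Defs
  imports "HOL-Analysis.Analysis" "HOL-Computational_Algebra.Polynomial"
begin

text \<open>
  On \<^typ>\<open>real ^ 'n ^ 'm\<close> (matrices with rows indexed by 'm and columns by 'n) the library's
  \<^const>\<open>inner\<close> and \<^const>\<open>norm\<close> are the trace inner product and the Frobenius norm.
\<close>

definition gradient :: "('a::real_inner \<Rightarrow> real) \<Rightarrow> 'a \<Rightarrow> 'a" where
  "gradient f X = (THE D. GDERIV f X :> D)"

definition convex_differentiable :: "('a::real_inner \<Rightarrow> real) \<Rightarrow> bool" where
  "convex_differentiable f \<longleftrightarrow> convex_on UNIV f \<and> (\<forall>X. f differentiable (at X))"

definition smooth :: "real \<Rightarrow> ('a::real_inner \<Rightarrow> real) \<Rightarrow> bool" where
  "smooth L f \<longleftrightarrow> convex_differentiable f \<and>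
     (\<forall>X Y. norm (gradient f X - gradient f Y) \<le> L * norm (X - Y))"

definition strongly_convex :: "real \<Rightarrow> ('a::real_inner \<Rightarrow> real) \<Rightarrow> bool" where
  "strongly_convex \<mu> f \<longleftrightarrow> convex_differentiable f \<and>
     (\<forall>X Y. f Y \<ge> f X + inner (gradient f X) (Y - X) + \<mu> / 2 * (norm (Y - X))\<^sup>2)"

definition char_polynomial :: "real ^ 'n ^ 'n \<Rightarrow> real poly" where
  "char_polynomial A = det (\<chi> i j. (if i = j then [:0, 1:] else 0) - [:A $ i $ j:])"

text \<open>
  The \<open>i\<close>-th largest singular value, counted with multiplicity and with \<open>i\<close> starting at 1:
  the square root of the \<open>i\<close>-th largest eigenvalue of \<open>A\<^sup>T A\<close>. It is set to 0 outside the
  range \<open>1 \<le> i \<le> CARD('n)\<close>; for \<open>CARD('m) < i \<le> CARD('n)\<close> it is 0 because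
  \<open>A\<^sup>T A\<close> has rank at most \<open>CARD('m)\<close>.
\<close>
definition singular_value :: "nat \<Rightarrow> real ^ 'n ^ 'm \<Rightarrow> real" where
  "singular_value i A =
     (let es = rev (sorted_list_of_multiset (proots (char_polynomial (transpose A ** A))))
      in if 1 \<le> i \<and> i \<le> length es then sqrt (es ! (i - 1)) else 0)"

definition best_rank_approx :: "nat \<Rightarrow> real ^ 'n ^ 'm \<Rightarrow> real ^ 'n ^ 'm \<Rightarrow> bool" where
  "best_rank_approx r X Xr \<longleftrightarrow> is_arg_min (\<lambda>Z. norm (X - Z)) (\<lambda>Z. rank Z \<le> r) Xr"

definition outer :: "real ^ 'm \<Rightarrow> real ^ 'n \<Rightarrow> real ^ 'n ^ 'm" where
  "outer a b = (\<chi> i j. a $ i * b $ j)"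

definition orthonormal_family :: "nat \<Rightarrow> (nat \<Rightarrow> real ^ 'n) \<Rightarrow> bool" where
  "orthonormal_family p a \<longleftrightarrow>
     (\<forall>i\<in>{1..p}. \<forall>j\<in>{1..p}. inner (a i) (a j) = (if i = j then 1 else 0))"

definition is_svd :: "real ^ 'n ^ 'm \<Rightarrow> (nat \<Rightarrow> real ^ 'm) \<Rightarrow> (nat \<Rightarrow> real ^ 'n) \<Rightarrow> bool" where
  "is_svd M a b \<longleftrightarrow>
     (let p = min CARD('m) CARD('n) in
        orthonormal_family p a \<and> orthonormal_family p b \<and>
        M = (\<Sum>i = 1..p. singular_value i M *\<^sub>R outer (a i) (b i)))"

text \<open>
  \<open>A \<Sigma> B\<^sup>T\<close> consists of the leading \<open>r = CARD('r)\<close> terms of some singular value decomposition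
  of \<open>M\<close>. The bijection \<open>e\<close> numbers the elements of the unordered index type 'r.
\<close>
definition is_truncated_svd ::
  "real ^ 'n ^ 'm \<Rightarrow> real ^ 'r ^ 'm \<Rightarrow> real ^ 'r ^ 'r \<Rightarrow> real ^ 'r ^ 'n \<Rightarrow> bool" where
  "is_truncated_svd M A S B \<longleftrightarrow>
     CARD('r) \<le> min CARD('m) CARD('n) \<and>
     (\<exists>a b (e :: 'r \<Rightarrow> nat). is_svd M a b \<and> bij_betw e UNIV {1..CARD('r)} \<and>
        (\<forall>k. column k A = a (e k) \<and> column k B = b (e k)) \<and>
        S = (\<chi> k l. if k = l then singular_value (e k) M else 0))"

text \<open>Square root of a diagonal matrix with nonnegative entries.\<close>
definition diag_sqrt :: "real ^ 'r ^ 'r \<Rightarrow> real ^ 'r ^ 'r" where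
  "diag_sqrt S = (\<chi> k l. if k = l then sqrt (S $ k $ k) else 0)"

definition vstack :: "real ^ 'r ^ 'm \<Rightarrow> real ^ 'r ^ 'n \<Rightarrow> real ^ 'r ^ ('m + 'n)" where
  "vstack U V = (\<chi> i. case i of Inl k \<Rightarrow> U $ k | Inr k \<Rightarrow> V $ k)"

definition balanced_factors :: "real ^ 'n ^ 'm \<Rightarrow> ((real ^ 'r ^ 'm) \<times> (real ^ 'r ^ 'n)) set" where
  "balanced_factors X =
     {(U, V). U ** transpose V = X \<and>
        (\<forall>i\<in>{1..CARD('r)}. singular_value i U = sqrt (singular_value i X) \<and>
                            singular_value i V = sqrt (singular_value i X))}"

text \<open>
  The minimum over the set of balanced factorizations is written as an infimum: the set is
  compact, and nonempty whenever \<open>rank X \<le> CARD('r) \<le> min CARD('m) CARD('n)\<close>, so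
  the infimum is then attained.
\<close>
definition Dist :: "real ^ 'r ^ 'm \<Rightarrow> real ^ 'r ^ 'n \<Rightarrow> real ^ 'n ^ 'm \<Rightarrow> real" where
  "Dist U V X =
     (INF (U', V') \<in> balanced_factors X. norm (vstack U V - vstack U' V'))"

end

theory Submission
  imports Defs
begin

text \<open>
  Let \<open>M = - \<nabla>f(0)/L\<close>. The descent lemma at \<open>0\<close> together with strong convexity gives
  \<open>\<parallel>M - X\<^sup>*\<parallel>\<^sup>2 \<le> (1 - \<mu>/L) \<parallel>X\<^sup>*\<parallel>\<^sup>2\<close>, which is small compared with \<open>\<sigma>\<^sub>r(X\<^sub>r)\<^sup>2\<close> by the bound on
  \<open>\<kappa>\<close>. Hence \<open>M\<close> is close to \<open>X\<^sub>r\<close>, and by the Eckart--Young theorem its rank-\<open>r\<close> truncation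
  \<open>U\<^sub>0 V\<^sub>0\<^sup>T\<close> is at most twice as far from \<open>X\<^sub>r\<close>. To pass from products to factors, stack the
  factors of \<open>X\<^sub>r\<close> into \<open>W\<close> and those of the truncation into \<open>W\<^sub>0\<close>. Balancedness gives
  \<open>\<parallel>W\<^sub>0 W\<^sub>0\<^sup>T - W W\<^sup>T\<parallel> \<le> 2 \<parallel>U\<^sub>0 V\<^sub>0\<^sup>T - X\<^sub>r\<parallel>\<close>, and once \<open>W\<close> is rotated so that \<open>W\<^sub>0\<^sup>T W R\<close> is
  symmetric positive semidefinite, \<open>\<sigma>\<^sub>r(X\<^sub>r) \<parallel>W\<^sub>0 - W R\<parallel>\<^sup>2\<close> is at most a constant times
  \<open>\<parallel>W\<^sub>0 W\<^sub>0\<^sup>T - W W\<^sup>T\<parallel>\<^sup>2\<close>.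
\<close>

section \<open>A gradient step\<close>

text \<open>The derivative is represented by the vector of its values on the standard basis, and
  derivatives are unique, so the definite description in \<open>gradient\<close> denotes that
  vector.\<close>

lemma GDERIV_gradient:
  fixes f :: "'a::euclidean_space \<Rightarrow> real"
  assumes "f differentiable (at X)"
  shows "GDERIV f X :> gradient f X"
proof -
  obtain f' where f': "(f has_derivative f') (at X)"
    using assms by (auto simp: differentiable_def)
  then interpret bounded_linear f' by (rule has_derivative_bounded_linear)
  define D where "D = (\<Sum>b\<in>Basis. f' b *\<^sub>R b)"
  have "f' h = h \<bullet> D" for h
  proof -
    have "f' h = f' (\<Sum>b\<in>Basis. (h \<bullet> b) *\<^sub>R b)" by (simp add: euclidean_representation)
    also have "\<dots> = h \<bullet> D"
      by (simp add: D_def sum scaleR inner_sum_right mult.commute)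
    finally show ?thesis .
  qed
  then have "f' = (\<lambda>h. h \<bullet> D)" by auto
  with f' have D: "GDERIV f X :> D" by (simp add: gderiv_def)
  have "E = D" if "GDERIV f X :> E" for E
  proof -
    have "(\<lambda>h. h \<bullet> E) = (\<lambda>h. h \<bullet> D)"
      using that D unfolding gderiv_def by (rule has_derivative_unique)
    then have "\<forall>h. h \<bullet> E = h \<bullet> D" by metis
    then show ?thesis by (simp add: vector_eq_ldot)
  qed
  with D show ?thesis unfolding gradient_def by (metis theI)
qed

text \<open>\<open>\<psi>\<close> is f along the segment minus the linear and quadratic terms of the
  model. Cauchy-Schwarz and the Lipschitz gradient make its derivative nonpositive on [0,1];
  comparing the endpoints replaces an integration.\<close>

lemma smooth_upper_bound:
  fixes f :: "'a::euclidean_space \<Rightarrow> real"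
  assumes "smooth L f"
  shows "f (X + H) \<le> f X + gradient f X \<bullet> H + L / 2 * (norm H)\<^sup>2"
proof -
  define \<psi> where "\<psi> t = f (X + t *\<^sub>R H) - t * (gradient f X \<bullet> H) - L / 2 * (norm H)\<^sup>2 * t\<^sup>2" for t
  have der: "(\<psi> has_real_derivative
      (gradient f (X + t *\<^sub>R H) - gradient f X) \<bullet> H - L * (norm H)\<^sup>2 * t) (at t)" for t
  proof -
    have "f differentiable (at (X + t *\<^sub>R H))"
      using assms by (simp add: smooth_def convex_differentiable_def)
    then have "(f has_derivative (\<lambda>h. h \<bullet> gradient f (X + t *\<^sub>R H))) (at (X + t *\<^sub>R H))"
      using GDERIV_gradient by (auto simp: gderiv_def)
    moreover have "((\<lambda>t. X + t *\<^sub>R H) has_derivative (\<lambda>h. h *\<^sub>R H)) (at t)"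
      by (auto intro!: derivative_eq_intros)
    ultimately have "((\<lambda>t. f (X + t *\<^sub>R H)) has_derivative
        (\<lambda>h. (h *\<^sub>R H) \<bullet> gradient f (X + t *\<^sub>R H))) (at t)"
      using has_derivative_compose[of "\<lambda>t. X + t *\<^sub>R H" _ t UNIV f] by blast
    then have "((\<lambda>t. f (X + t *\<^sub>R H)) has_real_derivative (gradient f (X + t *\<^sub>R H) \<bullet> H)) (at t)"
      by (simp add: has_field_derivative_def inner_commute mult.commute[of _ "_ \<bullet> _"] fun_eq_iff
          mult_commute_abs)
    then show ?thesis unfolding \<psi>_def
      by (auto intro!: derivative_eq_intros simp: inner_diff_left)
  qed
  have "\<psi> 1 \<le> \<psi> 0"
  proof (rule DERIV_nonpos_imp_nonincreasing[of 0 1 \<psi>])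
    fix t :: real assume t: "0 \<le> t" "t \<le> 1"
    have "(gradient f (X + t *\<^sub>R H) - gradient f X) \<bullet> H
        \<le> norm (gradient f (X + t *\<^sub>R H) - gradient f X) * norm H" by (rule norm_cauchy_schwarz)
    also have "\<dots> \<le> (L * norm (X + t *\<^sub>R H - X)) * norm H"
      using assms unfolding smooth_def by (intro mult_right_mono) (blast, simp)
    also have "\<dots> = L * (norm H)\<^sup>2 * t" using t by (simp add: power2_eq_square)
    finally show "\<exists>y. (\<psi> has_real_derivative y) (at t) \<and> y \<le> 0" using der[of t] by auto
  qed simp
  then show ?thesis by (simp add: \<psi>_def)
qed

text \<open>The lower and upper quadratic models at 0 are compared at a unit vector. It yields
  positivity of L from that of \<mu>.\<close>

lemma strongly_convex_le_smooth:
  fixes f :: "'a::euclidean_space \<Rightarrow> real"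
  assumes "smooth L f" "strongly_convex \<mu> f"
  shows "\<mu> \<le> L"
proof -
  obtain H :: 'a where H: "H \<in> Basis" using nonempty_Basis by blast
  have "f H \<ge> f 0 + gradient f 0 \<bullet> (H - 0) + \<mu> / 2 * (norm (H - 0))\<^sup>2"
    using assms(2) unfolding strongly_convex_def by blast
  moreover have "f (0 + H) \<le> f 0 + gradient f 0 \<bullet> H + L / 2 * (norm H)\<^sup>2"
    by (rule smooth_upper_bound[OF assms(1)])
  ultimately show ?thesis using H by simp
qed

text \<open>The descent lemma along the step bounds the minimum above by f(X) - |g|^2/(2L), and
  strong convexity bounds it below. Together they bound the inner product of g and X - Z from below,
  and the term |g|^2/L^2 in the expanded square then cancels exactly.\<close>

lemma gradient_step_contraction:
  fixes f :: "'a::euclidean_space \<Rightarrow> real"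
  assumes "smooth L f" "strongly_convex \<mu> f" "0 < L" "\<And>Y. f Z \<le> f Y"
  shows "(norm (X - (1 / L) *\<^sub>R gradient f X - Z))\<^sup>2 \<le> (1 - \<mu> / L) * (norm (X - Z))\<^sup>2"
proof -
  define g where "g = gradient f X"
  have "f Z \<ge> f X + g \<bullet> (Z - X) + \<mu> / 2 * (norm (Z - X))\<^sup>2"
    using assms(2) by (simp add: strongly_convex_def g_def)
  moreover have "f Z \<le> f X - (norm g)\<^sup>2 / (2 * L)"
  proof -
    have "f Z \<le> f (X + (- (1 / L)) *\<^sub>R g)" by (rule assms(4))
    also have "\<dots> \<le> f X + g \<bullet> ((- (1 / L)) *\<^sub>R g) + L / 2 * (norm ((- (1 / L)) *\<^sub>R g))\<^sup>2"
      unfolding g_def by (rule smooth_upper_bound[OF assms(1)])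
    also have "\<dots> = f X - (norm g)\<^sup>2 / (2 * L)"
      using \<open>0 < L\<close> by (simp add: power_mult_distrib power_divide flip: power2_norm_eq_inner)
        (simp add: field_simps power2_eq_square)
    finally show ?thesis .
  qed
  ultimately have "g \<bullet> (X - Z) \<ge> \<mu> / 2 * (norm (X - Z))\<^sup>2 + (norm g)\<^sup>2 / (2 * L)"
    by (simp add: inner_diff_right norm_minus_commute)
  then have "2 / L * (g \<bullet> (X - Z)) \<ge> 2 / L * (\<mu> / 2 * (norm (X - Z))\<^sup>2 + (norm g)\<^sup>2 / (2 * L))"
    using \<open>0 < L\<close> by (intro mult_left_mono) auto
  moreover have "(norm (X - (1 / L) *\<^sub>R g - Z))\<^sup>2
      = (norm (X - Z))\<^sup>2 - 2 / L * (g \<bullet> (X - Z)) + (norm g)\<^sup>2 / L\<^sup>2"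
    unfolding power2_norm_eq_inner
    by (simp add: inner_diff_left inner_diff_right inner_commute algebra_simps power2_eq_square)
  moreover have "2 / L * (\<mu> / 2 * (norm (X - Z))\<^sup>2 + (norm g)\<^sup>2 / (2 * L))
      = \<mu> / L * (norm (X - Z))\<^sup>2 + (norm g)\<^sup>2 / L\<^sup>2"
    using \<open>0 < L\<close> by (simp add: field_simps power2_eq_square)
  ultimately show ?thesis unfolding g_def[symmetric] left_diff_distrib by linarith
qed

section \<open>Orthonormal eigenbases and singular values\<close>

text \<open>
  The induction splits off a minimizer of the Rayleigh quotient as the last basis vector, so
  that the eigenvalues come out in decreasing order.
\<close>

lemma self_adjoint_eigenbasis_subspace:
  fixes T :: "real ^ 'n \<Rightarrow> real ^ 'n"
  assumes lin: "linear T" and sa: "\<And>x y. T x \<bullet> y = x \<bullet> T y"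
    and "subspace S" "T ` S \<subseteq> S" "dim S = k"
  shows "\<exists>q l. orthonormal_family k q \<and> (\<forall>i\<in>{1..k}. q i \<in> S \<and> T (q i) = l i *\<^sub>R q i) \<and>
    (\<forall>i\<in>{1..k}. \<forall>j\<in>{1..k}. i \<le> j \<longrightarrow> l j \<le> (l i :: real))"
  using assms(3-5)
proof (induction k arbitrary: S)
  case 0
  then show ?case by (auto simp: orthonormal_family_def)
next
  case (Suc k)
  have cont: "continuous_on A T" for A using lin by (rule linear_continuous_on_compose[OF continuous_on_id])
  have "compact (S \<inter> sphere 0 1)"
    using closed_subspace[OF Suc.prems(1)] by (simp add: closed_Int_compact)
  moreover have "S \<inter> sphere 0 1 \<noteq> {}"
  proof -
    have "\<not> S \<subseteq> {0}" using Suc.prems(3) dim_eq_0[of S] by auto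
    then obtain y where "y \<in> S" "y \<noteq> 0" by auto
    then have "y /\<^sub>R norm y \<in> S \<inter> sphere 0 1"
      using Suc.prems(1) by (auto simp: subspace_scale)
    then show ?thesis by blast
  qed
  ultimately obtain x where "x \<in> S \<inter> sphere 0 1" "\<forall>y \<in> S \<inter> sphere 0 1. x \<bullet> T x \<le> y \<bullet> T y"
    using continuous_attains_inf[of "S \<inter> sphere 0 1" "\<lambda>y. y \<bullet> T y"]
      continuous_on_inner[OF continuous_on_id cont] by blast
  then have x: "x \<in> S" "norm x = 1"
    and min: "\<And>y. y \<in> S \<Longrightarrow> norm y = 1 \<Longrightarrow> x \<bullet> T x \<le> y \<bullet> T y"
    by auto
  define m where "m = x \<bullet> T x"
  \<comment> \<open>Homogeneous form of minimality: on \<open>S\<close> the quadratic form of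
    \<open>T\<close> minus m times the identity is nonnegative, and it vanishes at
    \<open>x\<close>.\<close>
  have B: "y \<bullet> T y - m * (y \<bullet> y) \<ge> 0" if "y \<in> S" for y
  proof (cases "y = 0")
    case True then show ?thesis using linear_0[OF lin] by simp
  next
    case False
    have "m \<le> (y /\<^sub>R norm y) \<bullet> T (y /\<^sub>R norm y)"
      unfolding m_def using False that Suc.prems(1) by (intro min) (auto simp: subspace_scale)
    also have "\<dots> = (y \<bullet> T y) / (y \<bullet> y)"
      by (simp add: linear_scale[OF lin] divide_inverse power2_eq_square flip: power2_norm_eq_inner)
    finally show ?thesis using False by (simp add: pos_le_divide_eq)
  qed
  define z where "z = T x - m *\<^sub>R x"
  have z: "z \<in> S" unfolding z_def
    using x Suc.prems by (auto intro!: subspace_diff subspace_scale)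
  have xx: "x \<bullet> x = 1" using x by (simp add: norm_eq_1)
  \<comment> \<open>The form at x + t z has first-order term 2 t |z|^2, so a small negative t would
    make it negative unless the residual z is 0.\<close>
  have quad: "2 * t * (z \<bullet> z) + t\<^sup>2 * (z \<bullet> T z - m * (z \<bullet> z)) \<ge> 0" for t
  proof -
    have "x + t *\<^sub>R z \<in> S" using x z Suc.prems(1) by (auto intro!: subspace_add subspace_scale)
    then have "(x + t *\<^sub>R z) \<bullet> T (x + t *\<^sub>R z) - m * ((x + t *\<^sub>R z) \<bullet> (x + t *\<^sub>R z)) \<ge> 0" by (rule B)
    moreover have "(x + t *\<^sub>R z) \<bullet> T (x + t *\<^sub>R z) - m * ((x + t *\<^sub>R z) \<bullet> (x + t *\<^sub>R z))
       = 2 * t * (z \<bullet> (T x - m *\<^sub>R x)) + t\<^sup>2 * (z \<bullet> T z - m * (z \<bullet> z))"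
    proof -
      have "x \<bullet> T z = z \<bullet> T x" using sa[of x z] by (simp add: inner_commute)
      then show ?thesis using xx m_def
        by (simp add: linear_add[OF lin] linear_scale[OF lin] inner_simps inner_commute[of x z]
            algebra_simps power2_eq_square)
    qed
    ultimately show ?thesis by (simp add: z_def)
  qed
  have "z = 0"
  proof (rule ccontr)
    assume "z \<noteq> 0"
    define a b where "a = z \<bullet> z" and "b = z \<bullet> T z - m * (z \<bullet> z)"
    have a: "a > 0" using \<open>z \<noteq> 0\<close> by (simp add: a_def)
    have b: "b \<ge> 0" using B[OF z] by (simp add: b_def)
    \<comment> \<open>With t = -a/(b+1) the linear term outweighs the quadratic one; the summand 1
      keeps the denominator positive when b = 0.\<close>
    have "2 * (- (a / (b + 1))) * a + (- (a / (b + 1)))\<^sup>2 * b \<ge> 0"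
      using quad unfolding a_def b_def by blast
    moreover have "2 * (- (a / (b + 1))) * a + (- (a / (b + 1)))\<^sup>2 * b = - (a\<^sup>2 * (b + 2) / (b + 1)\<^sup>2)"
      using b by (simp add: power2_eq_square divide_simps) (simp add: algebra_simps)
    moreover have "a\<^sup>2 * (b + 2) / (b + 1)\<^sup>2 > 0" using a b by simp
    ultimately show False by linarith
  qed
  then have Tx: "T x = m *\<^sub>R x" by (simp add: z_def)
  define S' where "S' = {y \<in> S. \<forall>w \<in> span {x}. orthogonal w y}"
  have S'_eq: "S' = {y \<in> S. x \<bullet> y = 0}"
    by (auto simp: S'_def span_singleton orthogonal_def)
  have "dim S' + dim (span {x}) = dim S" unfolding S'_def
    using x Suc.prems(1) by (intro dim_subspace_orthogonal_to_vectors) (auto simp: span_minimal)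
  moreover have "dim (span {x}) = 1"
    using x by (subst dim_span, subst dim_eq_card_independent) auto
  ultimately have "dim S' = k" using Suc.prems(3) by simp
  moreover have "subspace S'" unfolding S'_eq
    using Suc.prems(1) by (auto simp: subspace_def inner_simps)
  moreover have "T ` S' \<subseteq> S'"
    using Suc.prems(2) sa[of x, symmetric] by (auto simp: S'_eq Tx)
  ultimately obtain q l where q: "orthonormal_family k q"
      "\<forall>i\<in>{1..k}. q i \<in> S' \<and> T (q i) = l i *\<^sub>R q i"
      "\<forall>i\<in>{1..k}. \<forall>j\<in>{1..k}. i \<le> j \<longrightarrow> l j \<le> (l i :: real)"
    using Suc.IH by blast
  \<comment> \<open>\<open>m\<close> is the least Rayleigh quotient on \<open>S\<close>, so placing
    it last keeps the eigenvalues decreasing.\<close>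
  have lm: "m \<le> l i" if "i \<in> {1..k}" for i
  proof -
    have "q i \<bullet> q i = 1" using q(1) that by (simp add: orthonormal_family_def)
    moreover have "q i \<in> S" using q(2) that by (simp add: S'_eq)
    ultimately show ?thesis using B[of "q i"] q(2) that by auto
  qed
  define q' l' where "q' = q(Suc k := x)" and "l' = l(Suc k := m)"
  have Ik: "i = Suc k \<or> i \<in> {1..k} \<and> i \<noteq> Suc k" if "i \<in> {1..Suc k}" for i using that by auto
  have "orthonormal_family (Suc k) q'"
    unfolding orthonormal_family_def
  proof (intro ballI)
    fix i j assume "i \<in> {1..Suc k}" "j \<in> {1..Suc k}"
    then show "q' i \<bullet> q' j = (if i = j then 1 else 0)"
      using Ik[of i] Ik[of j] q(1,2) xx
      by (auto simp: q'_def orthonormal_family_def S'_eq inner_commute)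
  qed
  moreover have "\<forall>i\<in>{1..Suc k}. q' i \<in> S \<and> T (q' i) = l' i *\<^sub>R q' i"
    using q(2) x Tx by (auto simp: q'_def l'_def S'_eq)
  moreover have "\<forall>i\<in>{1..Suc k}. \<forall>j\<in>{1..Suc k}. i \<le> j \<longrightarrow> l' j \<le> l' i"
    using q(3) lm by (auto simp: l'_def)
  ultimately show ?case by blast
qed

section \<open>Expansions in orthonormal families\<close>

lemma orthonormal_familyD:
  assumes "orthonormal_family p a" "i \<in> {1..p}" "j \<in> {1..p}"
  shows "a i \<bullet> a j = (if i = j then 1 else 0)"
  using assms by (auto simp: orthonormal_family_def)

lemma orthonormal_family_mono:
  "orthonormal_family p a \<Longrightarrow> k \<le> p \<Longrightarrow> orthonormal_family k a"
  by (auto simp: orthonormal_family_def)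

lemma orthonormal_family_inner_sum:
  assumes "orthonormal_family p a" "j \<in> {1..p}"
  shows "a j \<bullet> (\<Sum>i=1..p. c i *\<^sub>R a i) = c j"
proof -
  have "a j \<bullet> (\<Sum>i=1..p. c i *\<^sub>R a i) = (\<Sum>i=1..p. if i = j then c i else 0)"
    unfolding inner_sum_right
    by (rule sum.cong) (auto simp: orthonormal_familyD[OF assms(1) assms(2)])
  then show ?thesis using assms(2) by simp
qed

lemma orthonormal_family_sum_inner_sum:
  assumes "orthonormal_family p a"
  shows "(\<Sum>i=1..p. c i *\<^sub>R a i) \<bullet> (\<Sum>i=1..p. d i *\<^sub>R a i) = (\<Sum>i=1..p. c i * d i)"
  unfolding inner_sum_left inner_scaleR_left
  by (rule sum.cong) (simp_all only: orthonormal_family_inner_sum[OF assms])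

lemma inj_on_orthonormal_family:
  assumes "orthonormal_family p a" shows "inj_on a {1..p}"
proof (rule inj_onI)
  fix i j assume "i \<in> {1..p}" "j \<in> {1..p}" "a i = a j"
  then show "i = j"
    using orthonormal_familyD[OF assms, of i j] orthonormal_familyD[OF assms, of j j] by (auto split: if_splits)
qed

lemma independent_orthonormal_family:
  assumes "orthonormal_family p a" "I \<subseteq> {1..p}" shows "independent (a ` I)"
proof (rule pairwise_orthogonal_independent)
  show "pairwise orthogonal (a ` I)"
    unfolding pairwise_def orthogonal_def
  proof (intro ballI impI)
    fix x y assume "x \<in> a ` I" "y \<in> a ` I" "x \<noteq> y"
    then obtain i j where "i \<in> I" "j \<in> I" "x = a i" "y = a j" "i \<noteq> j" by blast
    moreover then have "i \<in> {1..p}" "j \<in> {1..p}" using assms(2) by blast+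
    ultimately show "x \<bullet> y = 0" using orthonormal_familyD[OF assms(1)] by metis
  qed
  show "0 \<notin> a ` I"
  proof
    assume "0 \<in> a ` I"
    then obtain i where "i \<in> I" "a i = 0" by auto
    then show False using orthonormal_familyD[OF assms(1), of i i] assms(2) by auto
  qed
qed

lemma dim_span_orthonormal_family:
  assumes "orthonormal_family p a" "I \<subseteq> {1..p}" shows "dim (span (a ` I)) = card I"
proof -
  have "inj_on a I" using inj_on_orthonormal_family[OF assms(1)] assms(2) by (rule inj_on_subset)
  then show ?thesis
    using dim_eq_card_independent[OF independent_orthonormal_family[OF assms]]
    by (simp add: card_image)
qed

text \<open>The residual is orthogonal to every \<open>q i\<close>, and these span the space by a
  dimension count, so the residual is orthogonal to itself.\<close>

lemma orthonormal_basis_expansion: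
  fixes q :: "nat \<Rightarrow> real ^ 'n"
  assumes "orthonormal_family CARD('n) q"
  shows "v = (\<Sum>i=1..CARD('n). (q i \<bullet> v) *\<^sub>R q i)"
proof -
  define w where "w = v - (\<Sum>i=1..CARD('n). (q i \<bullet> v) *\<^sub>R q i)"
  have "orthogonal w y" if y: "y \<in> q ` {1..CARD('n)}" for y
  proof -
    obtain j where "j \<in> {1..CARD('n)}" "y = q j" using y by blast
    then have "y \<bullet> w = 0" unfolding w_def inner_diff_right
      by (simp only: orthonormal_family_inner_sum[OF assms])
    then show ?thesis by (simp add: orthogonal_def inner_commute)
  qed
  moreover have "w \<in> span (q ` {1..CARD('n)})"
    using dim_span_orthonormal_family[OF assms order_refl] dim_eq_full by fastforce
  ultimately have "orthogonal w w" using orthogonal_to_span by blast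
  then show ?thesis by (simp add: orthogonal_self w_def)
qed

lemma matrix_vector_eq_sum_basis:
  fixes X :: "real ^ 'n ^ 'm"
  assumes "orthonormal_family CARD('n) q"
  shows "X *v v = (\<Sum>i=1..CARD('n). (q i \<bullet> v) *\<^sub>R (X *v q i))"
proof -
  have "X *v v = X *v (\<Sum>i=1..CARD('n). (q i \<bullet> v) *\<^sub>R q i)"
    using orthonormal_basis_expansion[OF assms, of v] by simp
  also have "\<dots> = (\<Sum>i=1..CARD('n). (q i \<bullet> v) *\<^sub>R (X *v q i))"
    by (simp add: linear_sum[OF matrix_vector_mul_linear] matrix_vector_mult_scaleR)
  finally show ?thesis .
qed

lemma orthonormal_basis_parseval:
  fixes q :: "nat \<Rightarrow> real ^ 'n"
  assumes "orthonormal_family CARD('n) q"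
  shows "(norm v)\<^sup>2 = (\<Sum>i=1..CARD('n). (q i \<bullet> v)\<^sup>2)"
proof -
  have "v \<bullet> v = (\<Sum>i=1..CARD('n). (q i \<bullet> v) *\<^sub>R q i) \<bullet> (\<Sum>i=1..CARD('n). (q i \<bullet> v) *\<^sub>R q i)"
    using orthonormal_basis_expansion[OF assms, of v] by simp
  also have "\<dots> = (\<Sum>i=1..CARD('n). (q i \<bullet> v)\<^sup>2)"
    by (simp only: orthonormal_family_sum_inner_sum[OF assms] power2_eq_square)
  finally show ?thesis by (simp add: power2_norm_eq_inner)
qed

lemma orthonormal_family_bessel:
  assumes "orthonormal_family p a"
  shows "(\<Sum>i=1..p. (a i \<bullet> v)\<^sup>2) \<le> (norm v)\<^sup>2"
proof -
  define s where "s = (\<Sum>i=1..p. (a i \<bullet> v) *\<^sub>R a i)"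
  have "s \<bullet> s = (\<Sum>i=1..p. (a i \<bullet> v)\<^sup>2)"
    unfolding s_def by (simp only: orthonormal_family_sum_inner_sum[OF assms] power2_eq_square)
  moreover have "s \<bullet> v = (\<Sum>i=1..p. (a i \<bullet> v)\<^sup>2)"
    by (simp add: s_def inner_sum_left power2_eq_square)
  moreover have "0 \<le> (v - s) \<bullet> (v - s)" by simp
  ultimately show ?thesis
    by (simp add: inner_diff_left inner_diff_right inner_commute power2_norm_eq_inner)
qed

section \<open>Singular values read off from an eigenbasis\<close>

lemma sum_const_poly: "(\<Sum>x\<in>A. [:f x:]) = [:\<Sum>x\<in>A. f x:]"
  by (induction A rule: infinite_finite_induct) auto

text \<open>With K = xI - A, P the constant matrix of eigenvectors and D the diagonal matrix of the
  factors x - l_i, one has KP = PD over the polynomial ring. The determinant of P is nonzero by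
  orthogonality and cancels. This settles multiplicities, on which the root multiset in
  \<open>singular_value\<close> depends.\<close>

lemma char_polynomial_eigenbasis:
  fixes A :: "real ^ 'n ^ 'n"
  assumes q: "orthonormal_family CARD('n) q"
    and eig: "\<And>i. i \<in> {1..CARD('n)} \<Longrightarrow> A *v q i = l i *\<^sub>R q i"
  shows "char_polynomial A = (\<Prod>i=1..CARD('n). [:- l i, 1:])"
proof -
  obtain e where e: "bij_betw e (UNIV :: 'n set) {1..CARD('n)}"
    using ex_bij_betw_finite_nat[of "UNIV :: 'n set"] bij_betw_iff_card[of "UNIV :: 'n set" "{1..CARD('n)}"]
    by auto
  have e_in: "e k \<in> {1..CARD('n)}" for k using e by (auto simp: bij_betw_def)
  have e_inj: "e k = e k' \<longleftrightarrow> k = k'" for k k' using e by (auto simp: bij_betw_def inj_on_def)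
  define P :: "real poly ^ 'n ^ 'n" where "P = (\<chi> i k. [:q (e k) $ i:])"
  define K :: "real poly ^ 'n ^ 'n" where "K = (\<chi> i j. (if i = j then [:0, 1:] else 0) - [:A $ i $ j:])"
  define D :: "real poly ^ 'n ^ 'n" where "D = (\<chi> k k'. if k = k' then [:- l (e k), 1:] else 0)"
  have "transpose P ** P = mat 1"
  proof -
    have "(\<Sum>i\<in>UNIV. [:q (e k) $ i:] * [:q (e k') $ i:]) = (if k = k' then 1 else 0)" for k k'
      using orthonormal_familyD[OF q e_in e_in, of k k'] e_inj[of k k']
      by (auto simp add: sum_const_poly inner_vec_def one_pCons mult.commute)
    then show ?thesis by (simp add: matrix_matrix_mult_def transpose_def mat_def P_def vec_eq_iff)
  qed
  then have "det (transpose P) * det P = 1" by (metis det_mul det_I)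
  then have detP: "det P \<noteq> 0" by auto
  have "K ** P = P ** D"
  proof -
    have "(\<Sum>j\<in>UNIV. ((if i = j then [:0, 1:] else 0) - [:A $ i $ j:]) * [:q (e k) $ j:]) =
        (\<Sum>j\<in>UNIV. [:q (e j) $ i:] * (if j = k then [:- l (e j), 1:] else 0))" for i k
    proof -
      have "(\<Sum>j\<in>UNIV. ((if i = j then [:0, 1:] else 0) - [:A $ i $ j:]) * [:q (e k) $ j:])
          = (\<Sum>j\<in>UNIV. (if i = j then [:0, 1:] * [:q (e k) $ j:] else 0) - [:A $ i $ j * q (e k) $ j:])"
        by (rule sum.cong) auto
      also have "\<dots> = [:0, 1:] * [:q (e k) $ i:] - [:(A *v q (e k)) $ i:]"
        by (simp add: sum_subtractf sum_const_poly matrix_vector_mult_def del: mult_pCons_right mult_pCons_left)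
      also have "\<dots> = [:q (e k) $ i:] * [:- l (e k), 1:]"
        using eig[OF e_in, of k] by simp
      also have "\<dots> = (\<Sum>j\<in>UNIV. [:q (e j) $ i:] * (if j = k then [:- l (e j), 1:] else 0))"
        by (simp add: if_distrib[of "\<lambda>x. _ * x"] cong: if_cong del: mult_pCons_right mult_pCons_left)
      finally show ?thesis .
    qed
    then show ?thesis by (simp add: matrix_matrix_mult_def P_def K_def D_def vec_eq_iff)
  qed
  then have "det K * det P = det P * det D" by (metis det_mul)
  then have "det K = det D" using detP by simp
  also have "det D = (\<Prod>k\<in>UNIV. [:- l (e k), 1:])"
    by (subst det_diagonal) (auto simp: D_def)
  also have "\<dots> = (\<Prod>i=1..CARD('n). [:- l i, 1:])"
    by (rule prod.reindex_bij_betw[OF e])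
  finally show ?thesis by (simp add: char_polynomial_def K_def)
qed

text \<open>The roots of the characteristic polynomial are the \<open>l i\<close> with multiplicity,
  and sorting then reversing returns them in the given decreasing order.\<close>

lemma singular_value_eigenbasis:
  fixes A :: "real ^ 'n ^ 'm"
  assumes q: "orthonormal_family CARD('n) q"
    and eig: "\<And>i. i \<in> {1..CARD('n)} \<Longrightarrow> (transpose A ** A) *v q i = l i *\<^sub>R q i"
    and dec: "\<And>i j. 1 \<le> i \<Longrightarrow> i \<le> j \<Longrightarrow> j \<le> CARD('n) \<Longrightarrow> l j \<le> l i"
  shows "singular_value i A = (if i \<in> {1..CARD('n)} then sqrt (l i) else 0)"
proof -
  define xs where "xs = map l [1..<Suc CARD('n)]"
  have "proots (char_polynomial (transpose A ** A)) = (\<Sum>i=1..CARD('n). {#l i#})"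
    by (simp only: char_polynomial_eigenbasis[OF q eig]) (simp add: proots_prod)
  also have "\<dots> = mset xs"
    unfolding xs_def mset_map mset_upt
    by (simp add: sum_unfold_sum_mset atLeastLessThanSuc_atLeastAtMost)
  also have "\<dots> = mset (rev xs)" by simp
  finally have "sorted_list_of_multiset (proots (char_polynomial (transpose A ** A))) = sort (rev xs)"
    by (simp only: sorted_list_of_multiset_mset)
  also have "sorted (rev xs)"
    unfolding sorted_rev_iff_nth_mono by (auto simp: xs_def simp del: upt_Suc intro!: dec)
  then have "sort (rev xs) = rev xs" by (rule sorted_sort_id)
  finally have "rev (sorted_list_of_multiset (proots (char_polynomial (transpose A ** A)))) = xs" by simp
  then show ?thesis by (auto simp: singular_value_def xs_def simp del: upt_Suc)
qed

lemma inner_matrix_vector_transpose: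
  fixes A :: "real ^ 'n ^ 'm"
  shows "(A *v x) \<bullet> y = x \<bullet> (transpose A *v y)"
  by (metis dot_lmul_matrix inner_commute transpose_matrix_vector transpose_transpose)

text \<open>The eigenvalue of the Gram matrix at a unit vector q_i is |X q_i|^2, hence nonnegative,
  so squaring its root recovers it. Monotonicity extends to all larger indices because the values
  past \<open>CARD('n)\<close> are the default 0.\<close>

lemma right_singular_basis_ex:
  fixes X :: "real ^ 'n ^ 'm"
  shows "\<exists>q. orthonormal_family CARD('n) q \<and>
    (\<forall>i\<in>{1..CARD('n)}. (transpose X ** X) *v q i = (singular_value i X)\<^sup>2 *\<^sub>R q i) \<and>
    (\<forall>i. singular_value i X \<ge> 0) \<and> (\<forall>i j. 1 \<le> i \<longrightarrow> i \<le> j \<longrightarrow> singular_value j X \<le> singular_value i X)"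
proof -
  define T where "T = (*v) (transpose X ** X)"
  have T: "T x \<bullet> y = (X *v x) \<bullet> (X *v y)" for x y
    by (metis T_def inner_commute inner_matrix_vector_transpose matrix_vector_mul_assoc)
  have sa: "T x \<bullet> y = x \<bullet> T y" for x y using T by (metis inner_commute)
  have "linear T" unfolding T_def by simp
  from self_adjoint_eigenbasis_subspace[OF this sa subspace_UNIV, of "CARD('n)"]
  obtain q l where q: "orthonormal_family CARD('n) q"
    and eig: "\<And>i. i \<in> {1..CARD('n)} \<Longrightarrow> T (q i) = l i *\<^sub>R q i"
    and dec: "\<forall>i\<in>{1..CARD('n)}. \<forall>j\<in>{1..CARD('n)}. i \<le> j \<longrightarrow> l j \<le> (l i :: real)"
    by (simp only: dim_UNIV DIM_cart DIM_real mult_1_right subset_UNIV) blast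
  have dec': "l j \<le> l i" if "1 \<le> i" "i \<le> j" "j \<le> CARD('n)" for i j using dec that by auto
  have pos: "l i \<ge> 0" if "i \<in> {1..CARD('n)}" for i
  proof -
    have "l i = T (q i) \<bullet> q i" using eig[OF that] orthonormal_familyD[OF q that that] by simp
    then show ?thesis by (simp add: T)
  qed
  have sv: "singular_value i X = (if i \<in> {1..CARD('n)} then sqrt (l i) else 0)" for i
    by (rule singular_value_eigenbasis[OF q]) (use eig dec' in \<open>auto simp: T_def\<close>)
  show ?thesis
  proof (intro exI conjI ballI allI impI)
    show "orthonormal_family CARD('n) q" by (rule q)
    fix i j :: nat
    show "0 \<le> singular_value i X" using pos[of i] by (auto simp: sv)
    show "singular_value j X \<le> singular_value i X" if "1 \<le> i" "i \<le> j"
      using that pos[of i] dec'[of i j] by (auto simp: sv)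
    show "(transpose X ** X) *v q i = (singular_value i X)\<^sup>2 *\<^sub>R q i" if "i \<in> {1..CARD('n)}"
      using eig[OF that] pos[OF that] that by (simp add: sv T_def)
  qed
qed

lemma singular_value_nonneg: "singular_value i X \<ge> 0"
  using right_singular_basis_ex[of X] by blast

lemma singular_value_antimono: "1 \<le> i \<Longrightarrow> i \<le> j \<Longrightarrow> singular_value j X \<le> singular_value i X"
  using right_singular_basis_ex[of X] by blast

text \<open>The right half of a singular value decomposition, with kernel vectors included so that
  it is a full basis. Left vectors are recovered as normalized images X q_i where the singular value
  is positive.\<close>

definition right_singular_basis :: "real ^ 'n ^ 'm \<Rightarrow> (nat \<Rightarrow> real ^ 'n) \<Rightarrow> bool" where
  "right_singular_basis X q \<longleftrightarrow> orthonormal_family CARD('n) q \<and>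
    (\<forall>i\<in>{1..CARD('n)}. (transpose X ** X) *v q i = (singular_value i X)\<^sup>2 *\<^sub>R q i)"

lemma right_singular_basis_obtain:
  obtains q where "right_singular_basis X q"
  using right_singular_basis_ex[of X] unfolding right_singular_basis_def by blast

lemma right_singular_basis_inner:
  fixes X :: "real ^ 'n ^ 'm"
  assumes "right_singular_basis X q" "i \<in> {1..CARD('n)}"
  shows "(X *v q i) \<bullet> (X *v v) = (singular_value i X)\<^sup>2 * (q i \<bullet> v)"
proof -
  have "(X *v q i) \<bullet> (X *v v) = ((transpose X ** X) *v q i) \<bullet> v"
    by (metis inner_commute inner_matrix_vector_transpose matrix_vector_mul_assoc)
  then show ?thesis using assms by (simp add: right_singular_basis_def)
qed

lemma right_singular_basis_norm:
  fixes X :: "real ^ 'n ^ 'm"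
  assumes "right_singular_basis X q"
  shows "(norm (X *v v))\<^sup>2 = (\<Sum>i=1..CARD('n). (singular_value i X)\<^sup>2 * (q i \<bullet> v)\<^sup>2)"
proof -
  have q: "orthonormal_family CARD('n) q" using assms by (simp add: right_singular_basis_def)
  have "(X *v v) \<bullet> (X *v v) = (\<Sum>i=1..CARD('n). (q i \<bullet> v) *\<^sub>R (X *v q i)) \<bullet> (X *v v)"
    using matrix_vector_eq_sum_basis[OF q, of X v] by simp
  also have "\<dots> = (\<Sum>i=1..CARD('n). (singular_value i X)\<^sup>2 * (q i \<bullet> v)\<^sup>2)"
    unfolding inner_sum_left
    by (rule sum.cong) (auto simp: right_singular_basis_inner[OF assms] power2_eq_square)
  finally show ?thesis by (simp add: power2_norm_eq_inner)
qed

lemma right_singular_basis_orthonormal: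
  "right_singular_basis (X :: real ^ 'n ^ 'm) q \<Longrightarrow> orthonormal_family CARD('n) q"
  by (simp add: right_singular_basis_def)

section \<open>The Frobenius norm through rows and through orthonormal bases\<close>

lemma norm_matrix_vector_rows:
  fixes X :: "real ^ 'n ^ 'm"
  shows "(norm (X *v v))\<^sup>2 = (\<Sum>i\<in>UNIV. (X $ i \<bullet> v)\<^sup>2)"
  unfolding power2_norm_eq_inner inner_vec_def[of "X *v v"]
  by (simp add: matrix_vector_mul_component power2_eq_square)

lemma norm_matrix_vector_le:
  fixes X :: "real ^ 'n ^ 'm"
  shows "norm (X *v v) \<le> norm X * norm v"
proof -
  have "(norm (X *v v))\<^sup>2 = (\<Sum>i\<in>UNIV. (X $ i \<bullet> v)\<^sup>2)"
    by (rule norm_matrix_vector_rows)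
  also have "\<dots> \<le> (\<Sum>i\<in>UNIV. (norm (X $ i))\<^sup>2 * (norm v)\<^sup>2)"
    by (intro sum_mono) (metis Cauchy_Schwarz_ineq power2_norm_eq_inner)
  also have "\<dots> = (norm X * norm v)\<^sup>2"
    unfolding power_mult_distrib power2_norm_eq_inner[of X] inner_vec_def[of X X]
    by (simp add: power2_norm_eq_inner sum_distrib_right)
  finally show ?thesis by (simp add: power2_le_iff_abs_le)
qed

text \<open>Parseval is applied to each row and the sums are interchanged.\<close>

lemma norm_matrix_basis:
  fixes A :: "real ^ 'n ^ 'm"
  assumes "orthonormal_family CARD('n) q"
  shows "(norm A)\<^sup>2 = (\<Sum>i=1..CARD('n). (norm (A *v q i))\<^sup>2)"
proof -
  have "(norm A)\<^sup>2 = (\<Sum>k\<in>UNIV. (norm (A $ k))\<^sup>2)"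
    by (simp add: power2_norm_eq_inner inner_vec_def[of A])
  also have "\<dots> = (\<Sum>k\<in>UNIV. \<Sum>i=1..CARD('n). (q i \<bullet> A $ k)\<^sup>2)"
    by (simp only: orthonormal_basis_parseval[OF assms])
  also have "\<dots> = (\<Sum>i=1..CARD('n). \<Sum>k\<in>UNIV. (q i \<bullet> A $ k)\<^sup>2)"
    by (rule sum.swap)
  also have "\<dots> = (\<Sum>i=1..CARD('n). (norm (A *v q i))\<^sup>2)"
    by (simp add: norm_matrix_vector_rows inner_commute)
  finally show ?thesis .
qed

text \<open>The characteristic polynomial has degree \<open>CARD('n)\<close>, so the root list is no
  longer than that and the default value 0 applies.\<close>

lemma singular_value_outside:
  fixes X :: "real ^ 'n ^ 'm"
  assumes "CARD('n) < i" shows "singular_value i X = 0"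
proof -
  have "length (sorted_list_of_multiset (proots (char_polynomial (transpose X ** X)))) \<le> CARD('n)"
  proof -
    obtain q where q: "right_singular_basis X q" by (rule right_singular_basis_obtain)
    have "char_polynomial (transpose X ** X) = (\<Prod>i=1..CARD('n). [:- ((singular_value i X)\<^sup>2), 1:])"
      using q by (intro char_polynomial_eigenbasis) (auto simp: right_singular_basis_def)
    also have "degree \<dots> = CARD('n)" by (subst degree_prod_eq_sum_degree) auto
    finally have "size (proots (char_polynomial (transpose X ** X))) \<le> CARD('n)"
      by (metis size_proots_le)
    then show ?thesis by (metis mset_sorted_list_of_multiset size_mset)
  qed
  then show ?thesis using assms by (auto simp: singular_value_def)
qed

lemma norm_matrix_right_singular_basis:
  fixes X :: "real ^ 'n ^ 'm"
  assumes "right_singular_basis X q" "i \<in> {1..CARD('n)}"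
  shows "norm (X *v q i) = singular_value i X"
proof -
  have "q i \<bullet> q i = 1"
    using orthonormal_familyD[OF right_singular_basis_orthonormal[OF assms(1)] assms(2) assms(2)] by simp
  then have "(norm (X *v q i))\<^sup>2 = (singular_value i X)\<^sup>2"
    using right_singular_basis_inner[OF assms, of "q i"] by (simp add: power2_norm_eq_inner)
  then show ?thesis by (simp add: singular_value_nonneg)
qed

lemma singular_value_le_norm:
  fixes X :: "real ^ 'n ^ 'm"
  shows "singular_value i X \<le> norm X"
proof (cases "i \<in> {1..CARD('n)}")
  case True
  obtain q where q: "right_singular_basis X q" by (rule right_singular_basis_obtain)
  have "norm (q i) = 1"
    using orthonormal_familyD[OF right_singular_basis_orthonormal[OF q] True True] by (simp add: norm_eq_1)
  then show ?thesis
    using norm_matrix_vector_le[of X "q i"] norm_matrix_right_singular_basis[OF q True] by simp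
next
  case False
  then show ?thesis using singular_value_outside[of i X] by (cases "i = 0") (auto simp: singular_value_def)
qed

lemma orthonormal_family_inner_span:
  assumes "orthonormal_family p q" "I \<subseteq> {1..p}" "v \<in> span (q ` I)" "i \<in> {1..p} - I"
  shows "q i \<bullet> v = 0"
proof -
  have "orthogonal (q i) y" if y: "y \<in> q ` I" for y
  proof -
    obtain j where "j \<in> I" "y = q j" using y by blast
    then show ?thesis using orthonormal_familyD[OF assms(1), of i j] assms(2,4)
      by (auto simp: orthogonal_def subset_iff)
  qed
  from orthogonal_to_span[OF assms(3) this] show ?thesis by (simp add: orthogonal_def)
qed

section \<open>Perturbation and low-rank approximation\<close>

text \<open>A Weyl inequality. The span of the first r right singular vectors of X and the span of
  those of Y from position r on have dimensions adding up to n + 1, so they share a nonzero v. On v,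
  X stretches by at least its r-th singular value and Y by at most its own.\<close>

lemma singular_value_perturbation:
  fixes X Y :: "real ^ 'n ^ 'm"
  assumes "1 \<le> r"
  shows "singular_value r X \<le> singular_value r Y + norm (X - Y)"
proof (cases "r \<le> CARD('n)")
  case False
  then show ?thesis using singular_value_outside[of r X] singular_value_nonneg[of r Y] by simp
next
  case True
  obtain q where q: "right_singular_basis X q" by (rule right_singular_basis_obtain)
  obtain q' where q': "right_singular_basis Y q'" by (rule right_singular_basis_obtain)
  note o = right_singular_basis_orthonormal[OF q] and o' = right_singular_basis_orthonormal[OF q']
  define S T where "S = span (q ` {1..r})" and "T = span (q' ` {r..CARD('n)})"
  have "dim S = r" unfolding S_def
    by (subst dim_span_orthonormal_family[OF o]) (use True in auto)
  moreover have "dim T = CARD('n) - r + 1" unfolding T_def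
    by (subst dim_span_orthonormal_family[OF o']) (use True assms in auto)
  moreover have "dim {x + y |x y. x \<in> S \<and> y \<in> T} + dim (S \<inter> T) = dim S + dim T"
    unfolding S_def T_def by (intro dim_sums_Int subspace_span)
  moreover have "dim {x + y |x y. x \<in> S \<and> y \<in> T} \<le> CARD('n)"
    using dim_subset_UNIV[of "{x + y |x y. x \<in> S \<and> y \<in> T}"] by simp
  ultimately have "dim (S \<inter> T) \<noteq> 0" using True by linarith
  then obtain v where v: "v \<in> S" "v \<in> T" "v \<noteq> 0" using dim_eq_0[of "S \<inter> T"] by auto
  have "(singular_value r X * norm v)\<^sup>2 \<le> (norm (X *v v))\<^sup>2"
  proof -
    have "(singular_value r X)\<^sup>2 * (q i \<bullet> v)\<^sup>2 \<le> (singular_value i X)\<^sup>2 * (q i \<bullet> v)\<^sup>2"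
      if "i \<in> {1..CARD('n)}" for i
    proof (cases "i \<le> r")
      case True
      then show ?thesis using that singular_value_antimono[of i r X] singular_value_nonneg[of r X]
        by (intro mult_right_mono power_mono) auto
    next
      case False
      then have "q i \<bullet> v = 0"
        using orthonormal_family_inner_span[OF o, of "{1..r}" v i] v that \<open>r \<le> CARD('n)\<close> by (auto simp: S_def)
      then show ?thesis by simp
    qed
    then show ?thesis
      unfolding right_singular_basis_norm[OF q] power_mult_distrib orthonormal_basis_parseval[OF o]
        sum_distrib_left by (intro sum_mono) blast
  qed
  then have 1: "singular_value r X * norm v \<le> norm (X *v v)" by (simp add: power2_le_iff_abs_le)
  have "(norm (Y *v v))\<^sup>2 \<le> (singular_value r Y * norm v)\<^sup>2"
  proof -
    have "(singular_value i Y)\<^sup>2 * (q' i \<bullet> v)\<^sup>2 \<le> (singular_value r Y)\<^sup>2 * (q' i \<bullet> v)\<^sup>2"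
      if "i \<in> {1..CARD('n)}" for i
    proof (cases "r \<le> i")
      case True
      then show ?thesis using assms singular_value_antimono[of r i Y] singular_value_nonneg[of i Y]
        by (intro mult_right_mono power_mono) auto
    next
      case False
      then have "q' i \<bullet> v = 0"
        using orthonormal_family_inner_span[OF o', of "{r..CARD('n)}" v i] v that assms by (auto simp: T_def)
      then show ?thesis by simp
    qed
    then show ?thesis
      unfolding right_singular_basis_norm[OF q'] power_mult_distrib orthonormal_basis_parseval[OF o']
        sum_distrib_left by (intro sum_mono) blast
  qed
  then have 2: "norm (Y *v v) \<le> singular_value r Y * norm v"
    using singular_value_nonneg[of r Y] by (simp add: power2_le_iff_abs_le)
  have "singular_value r X * norm v \<le> norm (Y *v v + (X - Y) *v v)"
    using 1 by (simp add: matrix_vector_mult_diff_rdistrib)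
  also have "\<dots> \<le> norm (Y *v v) + norm ((X - Y) *v v)" by (rule norm_triangle_ineq)
  also have "\<dots> \<le> singular_value r Y * norm v + norm (X - Y) * norm v"
    using 2 norm_matrix_vector_le[of "X - Y" v] by linarith
  finally have "singular_value r X * norm v \<le> (singular_value r Y + norm (X - Y)) * norm v"
    by (simp add: distrib_right)
  then show ?thesis using v(3) by simp
qed

text \<open>The images of the right singular vectors span the range, and by monotonicity those past
  position k vanish.\<close>

lemma rank_le_of_singular_value_eq_0:
  fixes X :: "real ^ 'n ^ 'm"
  assumes "singular_value (Suc k) X = 0"
  shows "rank X \<le> k"
proof -
  obtain q where q: "right_singular_basis X q" by (rule right_singular_basis_obtain)
  note o = right_singular_basis_orthonormal[OF q]
  let ?B = "(\<lambda>i. X *v q i) ` {1..k}"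
  have "X *v v \<in> span ?B" for v
    unfolding matrix_vector_eq_sum_basis[OF o, of X v]
  proof (intro span_sum span_scale)
    fix i assume i: "i \<in> {1..CARD('n)}"
    show "X *v q i \<in> span ?B"
    proof (cases "i \<le> k")
      case True
      then show ?thesis using i by (intro span_base) auto
    next
      case False
      then have "singular_value i X = 0"
        using assms singular_value_antimono[of "Suc k" i X] singular_value_nonneg[of i X] by simp
      then have "X *v q i = 0" using norm_matrix_right_singular_basis[OF q i] by simp
      then show ?thesis by (simp add: span_zero)
    qed
  qed
  then have "dim (range (\<lambda>v. X *v v)) \<le> card ?B"
    by (intro dim_le_card) auto
  also have "\<dots> \<le> k" using card_image_le[of "{1..k}" "\<lambda>i. X *v q i"] by simp
  finally show ?thesis by (simp add: rank_dim_range)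
qed

lemma left_singular_vectors_orthonormal:
  fixes X :: "real ^ 'n ^ 'm"
  assumes q: "right_singular_basis X q" and "1 \<le> r" "singular_value r X > 0"
  shows "orthonormal_family r (\<lambda>i. (1 / singular_value i X) *\<^sub>R (X *v q i))"
  unfolding orthonormal_family_def
proof (intro ballI)
  have r: "r \<le> CARD('n)" using assms singular_value_outside[of r X] by (cases "r \<le> CARD('n)") auto
  fix i j assume ij: "i \<in> {1..r}" "j \<in> {1..r}"
  have "singular_value i X > 0" "singular_value j X > 0"
    using ij assms singular_value_antimono[of i r X] singular_value_antimono[of j r X] by auto
  moreover have "(X *v q i) \<bullet> (X *v q j) = (singular_value i X)\<^sup>2 * (if i = j then 1 else 0)"
    using ij r right_singular_basis_inner[OF q, of i "q j"]
      orthonormal_familyD[OF right_singular_basis_orthonormal[OF q], of i j] by simp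
  ultimately show "((1 / singular_value i X) *\<^sub>R (X *v q i)) \<bullet> ((1 / singular_value j X) *\<^sub>R (X *v q j))
      = (if i = j then 1 else 0)"
    by (simp add: power2_eq_square)
qed

text \<open>The normalized left singular vectors are r orthonormal vectors in the range.\<close>

lemma le_rank_of_singular_value_pos:
  fixes X :: "real ^ 'n ^ 'm"
  assumes "1 \<le> r" "singular_value r X > 0"
  shows "r \<le> rank X"
proof -
  obtain q where q: "right_singular_basis X q" by (rule right_singular_basis_obtain)
  let ?p = "\<lambda>i. (1 / singular_value i X) *\<^sub>R (X *v q i)"
  have "r = dim (span (?p ` {1..r}))"
    using dim_span_orthonormal_family[OF left_singular_vectors_orthonormal[OF q assms] order_refl] by simp
  also have "\<dots> \<le> dim (range ((*v) X))"
  proof -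
    have "?p ` {1..r} \<subseteq> range ((*v) X)"
      by (auto simp flip: matrix_vector_mult_scaleR)
    then show ?thesis by (simp add: dim_subset)
  qed
  finally show ?thesis by (simp add: rank_dim_range)
qed

section \<open>Outer products, thin decompositions and best approximation\<close>

lemma outer_mult_vector: "outer a b *v v = (b \<bullet> v) *\<^sub>R a"
  by (simp add: outer_def matrix_vector_mult_def vec_eq_iff inner_vec_def sum_distrib_left mult.assoc
      mult.commute[of "sum _ _"])

lemma inner_outer: "outer a b \<bullet> outer c d = (a \<bullet> c) * (b \<bullet> d)"
  unfolding outer_def inner_vec_def sum_product by (simp add: mult_ac)

lemma sum_matrix_mult_vector:
  fixes A :: "'i \<Rightarrow> real ^ 'n ^ 'm"
  shows "(\<Sum>i\<in>I. A i) *v v = (\<Sum>i\<in>I. A i *v v)"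
  by (induction I rule: infinite_finite_induct) (auto simp: matrix_vector_mult_add_rdistrib)

text \<open>The rank bound forces all singular values past r to vanish, so the expansion of X v in
  the right singular basis stops after r terms; normalizing the images X q_i gives the left
  vectors.\<close>

lemma thin_svd_ex:
  fixes X :: "real ^ 'n ^ 'm"
  assumes "1 \<le> r" "singular_value r X > 0" "rank X \<le> r"
  shows "\<exists>p q. orthonormal_family r p \<and> orthonormal_family r q \<and>
    X = (\<Sum>i=1..r. singular_value i X *\<^sub>R outer (p i) (q i))"
proof -
  have r: "r \<le> CARD('n)" using assms singular_value_outside[of r X] by (cases "r \<le> CARD('n)") auto
  obtain q where q: "right_singular_basis X q" by (rule right_singular_basis_obtain)
  note o = right_singular_basis_orthonormal[OF q]
  define p where "p i = (1 / singular_value i X) *\<^sub>R (X *v q i)" for i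
  have "X *v v = (\<Sum>i=1..r. singular_value i X *\<^sub>R outer (p i) (q i)) *v v" for v
  proof -
    have "X *v v = (\<Sum>i=1..CARD('n). (q i \<bullet> v) *\<^sub>R (X *v q i))"
      by (rule matrix_vector_eq_sum_basis[OF o])
    also have "\<dots> = (\<Sum>i=1..r. (q i \<bullet> v) *\<^sub>R (X *v q i))"
    proof (rule sum.mono_neutral_right)
      show "\<forall>i\<in>{1..CARD('n)} - {1..r}. (q i \<bullet> v) *\<^sub>R (X *v q i) = 0"
      proof
        fix i assume i: "i \<in> {1..CARD('n)} - {1..r}"
        have "\<not> singular_value i X > 0"
          using le_rank_of_singular_value_pos[of i X] i assms(3) by auto
        then have "norm (X *v q i) = 0"
          using norm_matrix_right_singular_basis[OF q, of i] i singular_value_nonneg[of i X] by simp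
        then show "(q i \<bullet> v) *\<^sub>R (X *v q i) = 0" by simp
      qed
    qed (use r in auto)
    also have "\<dots> = (\<Sum>i=1..r. singular_value i X *\<^sub>R outer (p i) (q i)) *v v"
      unfolding sum_matrix_mult_vector
    proof (rule sum.cong)
      fix i assume "i \<in> {1..r}"
      then have "singular_value i X > 0" using assms singular_value_antimono[of i r X] by auto
      then show "(q i \<bullet> v) *\<^sub>R (X *v q i) = (singular_value i X *\<^sub>R outer (p i) (q i)) *v v"
        by (simp add: p_def outer_mult_vector flip: scaleR_matrix_vector_assoc)
    qed simp
    finally show ?thesis .
  qed
  then have "X = (\<Sum>i=1..r. singular_value i X *\<^sub>R outer (p i) (q i))" by (simp add: matrix_eq)
  moreover have "orthonormal_family r p"
    using left_singular_vectors_orthonormal[OF q assms(1,2)] by (simp add: p_def[abs_def])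
  moreover have "orthonormal_family r q" using orthonormal_family_mono[OF o r] .
  ultimately show ?thesis by blast
qed

lemma norm_sum_outer:
  assumes "orthonormal_family p a" "orthonormal_family p b" "I \<subseteq> {1..p}"
  shows "(norm (\<Sum>i\<in>I. s i *\<^sub>R outer (a i) (b i)))\<^sup>2 = (\<Sum>i\<in>I. (s i)\<^sup>2)"
proof -
  have fin: "finite I" using assms(3) by (rule finite_subset) simp
  have "(norm (\<Sum>i\<in>I. s i *\<^sub>R outer (a i) (b i)))\<^sup>2
      = (\<Sum>i\<in>I. \<Sum>j\<in>I. (s i * s j) * ((a i \<bullet> a j) * (b i \<bullet> b j)))"
    by (simp add: power2_norm_eq_inner inner_sum_left inner_sum_right inner_outer mult.assoc)
      (simp add: sum_distrib_left mult_ac inner_commute)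
  also have "\<dots> = (\<Sum>i\<in>I. \<Sum>j\<in>I. if i = j then (s i)\<^sup>2 else 0)"
  proof (intro sum.cong refl)
    fix i j assume "i \<in> I" "j \<in> I"
    then have "i \<in> {1..p}" "j \<in> {1..p}" using assms(3) by blast+
    then show "s i * s j * (a i \<bullet> a j * (b i \<bullet> b j)) = (if i = j then (s i)\<^sup>2 else 0)"
      using orthonormal_familyD[OF assms(1)] orthonormal_familyD[OF assms(2)]
      by (auto simp: power2_eq_square)
  qed
  also have "\<dots> = (\<Sum>i\<in>I. (s i)\<^sup>2)" using fin by simp
  finally show ?thesis .
qed

lemma norm_sum_outer_mult_vector:
  assumes "orthonormal_family p a"
  shows "(norm ((\<Sum>i=1..p. s i *\<^sub>R outer (a i) (b i)) *v v))\<^sup>2 = (\<Sum>i=1..p. (s i)\<^sup>2 * (b i \<bullet> v)\<^sup>2)"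
proof -
  have "(\<Sum>i=1..p. s i *\<^sub>R outer (a i) (b i)) *v v = (\<Sum>i=1..p. (s i * (b i \<bullet> v)) *\<^sub>R a i)"
    by (simp add: sum_matrix_mult_vector outer_mult_vector flip: scaleR_matrix_vector_assoc)
  then show ?thesis
    by (simp only: power2_norm_eq_inner orthonormal_family_sum_inner_sum[OF assms])
      (simp add: power2_eq_square mult_ac)
qed

text \<open>The right singular vectors w_i of Z with i > r lie in its kernel, so |M - Z|^2 is at
  least the sum of |M w_i|^2 over i > r. That sum is a weighted sum of the squared singular values
  of M, and the weights cannot make it smaller than the tail past r.\<close>

lemma eckart_young:
  fixes M Z :: "real ^ 'n ^ 'm"
  assumes svd: "is_svd M a b" and r: "1 \<le> r" "r \<le> min CARD('m) CARD('n)" and Z: "rank Z \<le> r"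
  shows "norm (M - (\<Sum>i=1..r. singular_value i M *\<^sub>R outer (a i) (b i))) \<le> norm (M - Z)"
proof -
  define p where "p = min CARD('m) CARD('n)"
  define \<sigma> where "\<sigma> i = singular_value i M" for i
  have a: "orthonormal_family p a" and b: "orthonormal_family p b"
    and M: "M = (\<Sum>i=1..p. \<sigma> i *\<^sub>R outer (a i) (b i))"
    using svd by (auto simp: is_svd_def p_def \<sigma>_def Let_def)
  have rp: "r \<le> p" using r by (simp add: p_def)
  obtain w where w: "right_singular_basis Z w" by (rule right_singular_basis_obtain)
  note ow = right_singular_basis_orthonormal[OF w]
  have rn: "r \<le> CARD('n)" using r by simp
  have split: "{1..p} = {1..r} \<union> {Suc r..p}" "{1..CARD('n)} = {1..r} \<union> {Suc r..CARD('n)}"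
    using rp rn r by auto
  have "M - (\<Sum>i=1..r. \<sigma> i *\<^sub>R outer (a i) (b i)) = (\<Sum>i=Suc r..p. \<sigma> i *\<^sub>R outer (a i) (b i))"
    unfolding M split(1) by (subst sum.union_disjoint) auto
  then have lhs: "(norm (M - (\<Sum>i=1..r. \<sigma> i *\<^sub>R outer (a i) (b i))))\<^sup>2 = (\<Sum>i=Suc r..p. (\<sigma> i)\<^sup>2)"
    using norm_sum_outer[OF a b, of "{Suc r..p}" \<sigma>] r by simp
  \<comment> \<open>\<open>c j\<close> is the squared length of the projection of \<open>b j\<close>
    onto the span of the first r right singular vectors of Z.\<close>
  define c where "c j = (\<Sum>i=1..r. (w i \<bullet> b j)\<^sup>2)" for j
  have bj: "(norm (b j))\<^sup>2 = 1" if "j \<in> {1..p}" for j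
    using orthonormal_familyD[OF b that that] by (simp add: power2_norm_eq_inner)
  have wi: "(norm (w i))\<^sup>2 = 1" if "i \<in> {1..CARD('n)}" for i
    using orthonormal_familyD[OF ow that that] by (simp add: power2_norm_eq_inner)
  have tail: "(\<Sum>i=Suc r..CARD('n). (w i \<bullet> b j)\<^sup>2) = 1 - c j" if "j \<in> {1..p}" for j
  proof -
    have "1 = (\<Sum>i=1..CARD('n). (w i \<bullet> b j)\<^sup>2)"
      using orthonormal_basis_parseval[OF ow, of "b j"] bj[OF that] by simp
    also have "\<dots> = c j + (\<Sum>i=Suc r..CARD('n). (w i \<bullet> b j)\<^sup>2)"
      unfolding c_def split(2) by (subst sum.union_disjoint) auto
    finally show ?thesis by simp
  qed
  have c0: "0 \<le> c j" for j unfolding c_def by (intro sum_nonneg) simp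
  have c1: "c j \<le> 1" if "j \<in> {1..p}" for j
    using orthonormal_family_bessel[OF orthonormal_family_mono[OF ow rn], of "b j"] bj[OF that]
    by (simp add: c_def)
  have csum: "(\<Sum>j=1..p. c j) \<le> r"
  proof -
    have "(\<Sum>j=1..p. c j) = (\<Sum>i=1..r. \<Sum>j=1..p. (b j \<bullet> w i)\<^sup>2)"
      unfolding c_def by (subst sum.swap) (simp add: inner_commute)
    also have "\<dots> \<le> (\<Sum>i=1..r. 1)"
    proof (rule sum_mono)
      fix i assume "i \<in> {1..r}"
      then have "i \<in> {1..CARD('n)}" using rn by auto
      then show "(\<Sum>j=1..p. (b j \<bullet> w i)\<^sup>2) \<le> 1"
        using orthonormal_family_bessel[OF b, of "w i"] wi[of i] by simp
    qed
    finally show ?thesis by simp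
  qed
  \<comment> \<open>The c_j lie in [0,1] and sum to at most r, so the right-hand side is least when
    c_j = 1 exactly for j \<le> r. To see this, \<sigma>_r is exchanged for \<sigma>_j: the bracket
    is nonnegative up to r and nonpositive beyond, so the decreasing order helps in both
    ranges.\<close>
  have "(\<Sum>i=Suc r..p. (\<sigma> i)\<^sup>2) \<le> (\<Sum>j=1..p. (\<sigma> j)\<^sup>2 * (1 - c j))"
  proof -
    have "0 \<le> (\<sigma> r)\<^sup>2 * (r - (\<Sum>j=1..p. c j))" using csum by simp
    also have "\<dots> = (\<Sum>j=1..p. (\<sigma> r)\<^sup>2 * ((if j \<le> r then 1 else 0) - c j))"
    proof -
      have "(\<Sum>j=1..p. (if j \<le> r then 1 else 0)) = (\<Sum>j=1..r. (1::real))"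
        unfolding split(1) by (subst sum.union_disjoint) auto
      then show ?thesis by (simp add: sum_subtractf flip: sum_distrib_left)
    qed
    also have "\<dots> \<le> (\<Sum>j=1..p. (\<sigma> j)\<^sup>2 * ((if j \<le> r then 1 else 0) - c j))"
    proof (rule sum_mono)
      fix j assume j: "j \<in> {1..p}"
      show "(\<sigma> r)\<^sup>2 * ((if j \<le> r then 1 else 0) - c j) \<le> (\<sigma> j)\<^sup>2 * ((if j \<le> r then 1 else 0) - c j)"
      proof (cases "j \<le> r")
        case True
        then have "(\<sigma> r)\<^sup>2 \<le> (\<sigma> j)\<^sup>2" using j singular_value_antimono[of j r M] singular_value_nonneg[of r M]
          by (intro power_mono) (auto simp: \<sigma>_def)
        then show ?thesis using c1[OF j] True by (intro mult_right_mono) auto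
      next
        case False
        then have "(\<sigma> j)\<^sup>2 \<le> (\<sigma> r)\<^sup>2" using r singular_value_antimono[of r j M] singular_value_nonneg[of j M]
          by (intro power_mono) (auto simp: \<sigma>_def)
        then show ?thesis using c0[of j] False by (simp add: mult_right_mono)
      qed
    qed
    also have "\<dots> = (\<Sum>j=1..p. (\<sigma> j)\<^sup>2 * (1 - c j) - (if j \<le> r then 0 else (\<sigma> j)\<^sup>2))"
      by (rule sum.cong) (auto simp: algebra_simps)
    also have "\<dots> = (\<Sum>j=1..p. (\<sigma> j)\<^sup>2 * (1 - c j)) - (\<Sum>i=Suc r..p. (\<sigma> i)\<^sup>2)"
    proof -
      have "(\<Sum>j=1..p. (if j \<le> r then 0 else (\<sigma> j)\<^sup>2)) = (\<Sum>i=Suc r..p. (\<sigma> i)\<^sup>2)"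
        unfolding split(1) by (subst sum.union_disjoint) auto
      then show ?thesis by (simp add: sum_subtractf)
    qed
    finally show ?thesis by simp
  qed
  also have "\<dots> = (\<Sum>j=1..p. \<Sum>i=Suc r..CARD('n). (\<sigma> j)\<^sup>2 * (b j \<bullet> w i)\<^sup>2)"
    by (rule sum.cong) (simp_all add: tail[symmetric] sum_distrib_left inner_commute)
  also have "\<dots> = (\<Sum>i=Suc r..CARD('n). (norm (M *v w i))\<^sup>2)"
    unfolding M norm_sum_outer_mult_vector[OF a] by (rule sum.swap)
  also have "\<dots> = (\<Sum>i=Suc r..CARD('n). (norm ((M - Z) *v w i))\<^sup>2)"
  proof (rule sum.cong)
    fix i assume i: "i \<in> {Suc r..CARD('n)}"
    \<comment> \<open>A positive value at i > r would force rank at least i; hence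
      \<open>w i\<close> is in the kernel of Z.\<close>
    have "\<not> singular_value i Z > 0"
      using le_rank_of_singular_value_pos[of i Z] i Z by auto
    then have "norm (Z *v w i) = 0"
      using norm_matrix_right_singular_basis[OF w, of i] i singular_value_nonneg[of i Z] by simp
    then show "(norm (M *v w i))\<^sup>2 = (norm ((M - Z) *v w i))\<^sup>2"
      by (simp add: matrix_vector_mult_diff_rdistrib)
  qed simp
  also have "\<dots> \<le> (\<Sum>i=1..CARD('n). (norm ((M - Z) *v w i))\<^sup>2)"
    by (rule sum_mono2) auto
  also have "\<dots> = (norm (M - Z))\<^sup>2" by (rule norm_matrix_basis[OF ow, symmetric])
  finally have "(norm (M - (\<Sum>i=1..r. \<sigma> i *\<^sub>R outer (a i) (b i))))\<^sup>2 \<le> (norm (M - Z))\<^sup>2"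
    by (simp only: lhs)
  then show ?thesis unfolding \<sigma>_def by (rule power2_le_imp_le) simp
qed

section \<open>Alignment of factors\<close>

lemma inner_transpose: "transpose A \<bullet> transpose B = A \<bullet> (B :: real ^ 'n ^ 'm)"
  unfolding inner_vec_def transpose_def by (simp, rule sum.swap)

lemma inner_matrix_mult_left:
  fixes A :: "real ^ 'k ^ 'm" and B :: "real ^ 'n ^ 'k"
  shows "(A ** B) \<bullet> C = B \<bullet> (transpose A ** C)"
proof -
  have "(A ** B) \<bullet> C = (\<Sum>i\<in>UNIV. \<Sum>j\<in>UNIV. \<Sum>k\<in>UNIV. A $ i $ k * B $ k $ j * C $ i $ j)"
    by (simp add: inner_vec_def matrix_matrix_mult_def sum_distrib_right)
  also have "\<dots> = (\<Sum>i\<in>UNIV. \<Sum>k\<in>UNIV. \<Sum>j\<in>UNIV. A $ i $ k * B $ k $ j * C $ i $ j)"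
    by (intro sum.cong refl, rule sum.swap)
  also have "\<dots> = (\<Sum>k\<in>UNIV. \<Sum>i\<in>UNIV. \<Sum>j\<in>UNIV. A $ i $ k * B $ k $ j * C $ i $ j)"
    by (rule sum.swap)
  also have "\<dots> = (\<Sum>k\<in>UNIV. \<Sum>j\<in>UNIV. \<Sum>i\<in>UNIV. A $ i $ k * B $ k $ j * C $ i $ j)"
    by (intro sum.cong refl, rule sum.swap)
  also have "\<dots> = B \<bullet> (transpose A ** C)"
    by (simp add: inner_vec_def matrix_matrix_mult_def transpose_def sum_distrib_left mult_ac)
  finally show ?thesis .
qed

text \<open>Inner products of outer-type products reduce to inner products of Gram-type matrices in
  the inner dimensions; the norms of differences of such products are expanded this way.\<close>

lemma inner_mult_transpose:
  fixes A :: "real ^ 'k ^ 'm" and B :: "real ^ 'k ^ 'n" and C :: "real ^ 'l ^ 'm" and D :: "real ^ 'l ^ 'n"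
  shows "(A ** transpose B) \<bullet> (C ** transpose D) = (transpose C ** A) \<bullet> (transpose D ** B)"
proof -
  have "(A ** transpose B) \<bullet> (C ** transpose D) = transpose B \<bullet> (transpose A ** (C ** transpose D))"
    by (rule inner_matrix_mult_left)
  also have "transpose A ** (C ** transpose D) = transpose (D ** (transpose C ** A))"
    by (simp add: matrix_transpose_mul matrix_mul_assoc)
  also have "transpose B \<bullet> transpose (D ** (transpose C ** A)) = (D ** (transpose C ** A)) \<bullet> B"
    by (simp only: inner_transpose inner_commute)
  also have "\<dots> = (transpose C ** A) \<bullet> (transpose D ** B)" by (rule inner_matrix_mult_left)
  finally show ?thesis .
qed

lemma inner_matrix_vector_rows:
  fixes A B :: "real ^ 'n ^ 'm"
  shows "(A ** transpose G) \<bullet> B = (\<Sum>i\<in>UNIV. (G *v A $ i) \<bullet> B $ i)"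
  by (simp add: inner_vec_def matrix_matrix_mult_def transpose_def matrix_vector_mult_def mult.commute)

text \<open>The hypothesis is applied to each row of D; the sum of the |Z d_i|^2 is the inner
  product of the two Gram matrices.\<close>

lemma norm_mult_transpose_lower:
  fixes D :: "real ^ 'r ^ 'm" and Z :: "real ^ 'r ^ 'k"
  assumes "\<And>d. c * (norm d)\<^sup>2 \<le> (norm (Z *v d))\<^sup>2"
  shows "c * (norm D)\<^sup>2 \<le> (transpose D ** D) \<bullet> (transpose Z ** Z)"
proof -
  have "c * (norm D)\<^sup>2 = (\<Sum>i\<in>UNIV. c * (norm (D $ i))\<^sup>2)"
    by (simp add: power2_norm_eq_inner inner_vec_def[of D] sum_distrib_left)
  also have "\<dots> \<le> (\<Sum>i\<in>UNIV. (norm (Z *v D $ i))\<^sup>2)" by (intro sum_mono assms)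
  also have "\<dots> = (\<Sum>i\<in>UNIV. ((transpose Z ** Z) *v D $ i) \<bullet> D $ i)"
    by (simp add: power2_norm_eq_inner inner_matrix_vector_transpose inner_commute
        flip: matrix_vector_mul_assoc)
  also have "\<dots> = (D ** transpose (transpose Z ** Z)) \<bullet> D" by (rule inner_matrix_vector_rows[symmetric])
  also have "\<dots> = transpose (transpose Z ** Z) \<bullet> (transpose D ** D)" by (rule inner_matrix_mult_left)
  finally show ?thesis by (simp add: matrix_transpose_mul inner_commute)
qed

text \<open>
  With \<open>D = W - Z\<close>, \<open>E = D\<^sup>T D\<close>, \<open>P = Z\<^sup>T D\<close> and \<open>S = Z\<^sup>T Z\<close>, the right-hand side expands to
  \<open>2\<langle>E,S\<rangle> + 2\<parallel>P\<parallel>\<^sup>2 + \<parallel>E\<parallel>\<^sup>2 + 4\<langle>P,E\<rangle>\<close>, from which the square of \<open>E + aP\<close> is split off. The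
  optimal choice is \<open>a = \<surd>2\<close>; the rational \<open>a = 7/5\<close> loses little and gives the factor \<open>4/5\<close>.
\<close>

lemma aligned_factor_bound:
  fixes W Z :: "real ^ 'r ^ 'k"
  assumes lower: "\<And>d. c * (norm d)\<^sup>2 \<le> (norm (Z *v d))\<^sup>2" and "0 \<le> c"
    and sym: "transpose (transpose Z ** W) = transpose Z ** W"
    and psd: "\<And>d. 0 \<le> ((transpose Z ** W) *v d) \<bullet> d"
  shows "4 / 5 * c * (norm (W - Z))\<^sup>2 \<le> (norm (W ** transpose W - Z ** transpose Z))\<^sup>2"
proof -
  define D where "D = W - Z"
  define E S G P where "E = transpose D ** D" and "S = transpose Z ** Z"
    and "G = transpose Z ** W" and "P = transpose Z ** D"
  have G: "G = P + S" by (simp add: G_def P_def S_def D_def flip: matrix_add_ldistrib)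
  have S: "transpose S = S" by (simp add: S_def matrix_transpose_mul)
  have "transpose P = transpose G - transpose S"
    by (simp add: G transpose_def vec_eq_iff)
  \<comment> \<open>P is symmetric, being the difference of the symmetric matrices G and S; this
    merges the cross terms of the expansion.\<close>
  then have P: "transpose D ** Z = P"
    using sym S G by (simp add: P_def G_def[symmetric] matrix_transpose_mul)
  have W: "W ** transpose W - Z ** transpose Z = D ** transpose Z + Z ** transpose D + D ** transpose D"
  proof -
    have "W = D + Z" by (simp add: D_def)
    moreover have "transpose (D + Z) = transpose D + transpose Z" by (simp add: transpose_def vec_eq_iff)
    moreover have "(D + Z) ** A = D ** A + Z ** A" for A :: "real ^ 'k ^ 'r"
      by (simp add: matrix_matrix_mult_def vec_eq_iff distrib_right sum.distrib)
    ultimately show ?thesis by (simp add: matrix_add_ldistrib)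
  qed
  have "(norm (W ** transpose W - Z ** transpose Z))\<^sup>2 = 2 * (E \<bullet> S) + 2 * (P \<bullet> P) + E \<bullet> E + 4 * (P \<bullet> E)"
    unfolding W power2_norm_eq_inner
    by (simp add: inner_add_left inner_add_right inner_mult_transpose P flip: E_def S_def P_def)
      (simp add: inner_commute)
  \<comment> \<open>The cross term with coefficient 4 is split as 14/5, absorbed by the square, plus
    6/5, written through P = G - S. The latter costs 6/5 of the 2 copies of
    \<open>E \<bullet> S\<close>, leaving 4/5.\<close>
  also have "\<dots> = (4 / 5 * (E \<bullet> S) + 6 / 5 * (G \<bullet> E)) + 1 / 25 * (P \<bullet> P)
      + (E + (7 / 5) *\<^sub>R P) \<bullet> (E + (7 / 5) *\<^sub>R P)"
    by (simp add: G inner_add_left inner_add_right inner_commute) (simp add: field_simps)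
  finally have "(norm (W ** transpose W - Z ** transpose Z))\<^sup>2 \<ge> 4 / 5 * (E \<bullet> S) + 6 / 5 * (G \<bullet> E)"
    using inner_ge_zero[of P] inner_ge_zero[of "E + (7 / 5) *\<^sub>R P"] by linarith
  moreover have "G \<bullet> E \<ge> 0"
  proof -
    have "G \<bullet> E = (D ** transpose G) \<bullet> D"
      unfolding inner_matrix_mult_left by (simp add: G_def E_def sym)
    also have "\<dots> = (\<Sum>i\<in>UNIV. (G *v D $ i) \<bullet> D $ i)" by (rule inner_matrix_vector_rows)
    also have "\<dots> \<ge> 0" unfolding G_def by (intro sum_nonneg psd)
    finally show ?thesis .
  qed
  moreover have "c * (norm D)\<^sup>2 \<le> E \<bullet> S"
    unfolding E_def S_def by (rule norm_mult_transpose_lower[OF lower])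
  ultimately show ?thesis unfolding D_def by linarith
qed

text \<open>A matrix with orthonormal columns times a diagonal matrix; \<open>e\<close> numbers the
  unordered column type. Weights 1 give the orthogonal factors of a decomposition, and roots of
  singular values give its balanced factors.\<close>

definition scaled_columns :: "('r \<Rightarrow> nat) \<Rightarrow> (nat \<Rightarrow> real) \<Rightarrow> (nat \<Rightarrow> real ^ 'm) \<Rightarrow> real ^ 'r ^ 'm" where
  "scaled_columns e t a = (\<chi> i k. t (e k) * a (e k) $ i)"

lemma scaled_columns_mult_transpose:
  assumes "bij_betw e (UNIV :: 'r::finite set) {1..r}"
  shows "scaled_columns e s a ** transpose (scaled_columns e t b) = (\<Sum>i=1..r. (s i * t i) *\<^sub>R outer (a i) (b i))"
proof -
  have "(\<Sum>k\<in>UNIV. s (e k) * a (e k) $ i * (t (e k) * b (e k) $ j)) = (\<Sum>k=1..r. s k * a k $ i * (t k * b k $ j))"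
    for i j by (rule sum.reindex_bij_betw[OF assms])
  then show ?thesis
    by (simp add: vec_eq_iff matrix_matrix_mult_def transpose_def scaled_columns_def outer_def mult_ac)
qed

text \<open>Orthonormality leaves only the weights, so factors built from the same \<open>e\<close>
  and weights are balanced whatever families they use.\<close>

lemma transpose_mult_scaled_columns:
  assumes e: "bij_betw e (UNIV :: 'r::finite set) {1..r}" and a: "orthonormal_family r a"
  shows "transpose (scaled_columns e s a) ** scaled_columns e t a
    = (\<chi> k l. if k = l then s (e k) * t (e k) else 0)"
proof -
  have "(\<Sum>i\<in>UNIV. s (e k) * a (e k) $ i * (t (e l) * a (e l) $ i)) = (if k = l then s (e k) * t (e k) else 0)" for k l
  proof -
    have "(\<Sum>i\<in>UNIV. s (e k) * a (e k) $ i * (t (e l) * a (e l) $ i)) = s (e k) * t (e l) * (a (e k) \<bullet> a (e l))"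
      by (simp add: inner_vec_def sum_distrib_left mult_ac)
    moreover have "e k = e l \<longleftrightarrow> k = l" using e by (auto simp: bij_betw_def inj_on_def)
    moreover have "e k \<in> {1..r}" "e l \<in> {1..r}" using e by (auto simp: bij_betw_def)
    ultimately show ?thesis using orthonormal_familyD[OF a, of "e k" "e l"] by simp
  qed
  then show ?thesis
    by (simp add: vec_eq_iff matrix_matrix_mult_def transpose_def scaled_columns_def)
qed

lemma orthogonal_matrix_norm:
  fixes R :: "real ^ 'r ^ 'r"
  assumes "transpose R ** R = mat 1" shows "norm (R *v d) = norm d"
  by (metis assms inner_matrix_vector_transpose matrix_vector_mul_assoc matrix_vector_mul_lid norm_eq)

text \<open>The factor \<open>R\<close> is the inverse of the orthogonal factor in the polar decomposition of \<open>M\<close>.\<close>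

lemma polar_invertible:
  fixes M :: "real ^ 'r ^ 'r"
  assumes "\<And>x. M *v x = 0 \<Longrightarrow> x = 0"
  shows "\<exists>R. transpose R ** R = mat 1 \<and> R ** transpose R = mat 1 \<and>
    transpose (M ** R) = M ** R \<and> (\<forall>d. 0 \<le> ((M ** R) *v d) \<bullet> d)"
proof -
  define r where "r = CARD('r)"
  have "1 \<le> r" by (simp add: r_def)
  obtain e where e: "bij_betw e (UNIV :: 'r set) {1..r}"
    using ex_bij_betw_finite_nat[of "UNIV :: 'r set"] bij_betw_iff_card[of "UNIV :: 'r set" "{1..r}"]
    by (auto simp: r_def)
  \<comment> \<open>Injectivity makes the least singular value positive, so the thin decomposition
    below has square orthogonal factors.\<close>
  have "singular_value r M > 0"
  proof (rule ccontr)
    assume *: "\<not> singular_value r M > 0"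
    obtain q where q: "right_singular_basis M q" by (rule right_singular_basis_obtain)
    have r: "r \<in> {1..CARD('r)}" by (simp add: r_def)
    have "M *v q r = 0"
      using norm_matrix_right_singular_basis[OF q r] * singular_value_nonneg[of r M] by simp
    then have "q r = 0" by (rule assms)
    then show False using orthonormal_familyD[OF right_singular_basis_orthonormal[OF q] r r] by simp
  qed
  moreover have "rank M \<le> r" using rank_bound[of M] by (simp add: r_def)
  ultimately obtain p q where p: "orthonormal_family r p" and q: "orthonormal_family r q"
    and M: "M = (\<Sum>i=1..r. singular_value i M *\<^sub>R outer (p i) (q i))"
    using thin_svd_ex[OF \<open>1 \<le> r\<close>, of M] by blast
  define s where "s i = sqrt (singular_value i M)" for i
  define P Q H where "P = scaled_columns e (\<lambda>_. 1) p" and "Q = scaled_columns e (\<lambda>_. 1) q"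
    and "H = scaled_columns e s p"
  have ss: "s i * s i = singular_value i M" for i by (simp add: s_def singular_value_nonneg)
  have P: "transpose P ** P = mat 1" and Q: "transpose Q ** Q = mat 1"
    unfolding P_def Q_def transpose_mult_scaled_columns[OF e p] transpose_mult_scaled_columns[OF e q]
    by (auto simp: mat_def vec_eq_iff)
  have P': "P ** transpose P = mat 1" and Q': "Q ** transpose Q = mat 1"
    using P Q matrix_left_right_inverse by blast+
  \<comment> \<open>If \<Sigma> is the diagonal matrix of singular values, M = P \<Sigma> Q^T, so M
    R = P \<Sigma> P^T = H H^T, which is symmetric and positive semidefinite.\<close>
  define R where "R = Q ** transpose P"
  have RR: "transpose R ** R = mat 1"
    by (simp add: R_def matrix_transpose_mul) (metis P' Q matrix_mul_assoc matrix_mul_lid)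
  then have "R ** transpose R = mat 1" using matrix_left_right_inverse by blast
  moreover have "M ** R = H ** transpose H"
  proof -
    have "M = H ** transpose (scaled_columns e s q)"
      unfolding H_def scaled_columns_mult_transpose[OF e] ss by (rule M)
    also have "transpose (scaled_columns e s q) = transpose H ** (P ** transpose Q)"
    proof -
      define Dg where "Dg = (\<chi> k l. if k = l then s (e k) else 0)"
      have *: "scaled_columns e s a = scaled_columns e (\<lambda>_. 1) a ** Dg" for a :: "nat \<Rightarrow> real ^ 'r"
        by (simp add: vec_eq_iff matrix_matrix_mult_def scaled_columns_def Dg_def if_distrib
            mult.commute cong: if_cong)
      have "transpose H ** (P ** transpose Q) = transpose Dg ** ((transpose P ** P) ** transpose Q)"
        by (simp only: H_def * matrix_transpose_mul matrix_mul_assoc flip: P_def)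
      also have "\<dots> = transpose (scaled_columns e s q)"
        by (simp add: P * matrix_transpose_mul flip: Q_def)
      finally show ?thesis by simp
    qed
    finally have "M ** R = H ** transpose H ** (P ** transpose Q ** (Q ** transpose P))"
      by (simp add: R_def matrix_mul_assoc)
    also have "P ** transpose Q ** (Q ** transpose P) = mat 1"
      by (metis P' Q matrix_mul_assoc matrix_mul_lid)
    finally show ?thesis by simp
  qed
  moreover have "((H ** transpose H) *v d) \<bullet> d = (transpose H *v d) \<bullet> (transpose H *v d)" for d
    by (simp add: inner_matrix_vector_transpose flip: matrix_vector_mul_assoc)
  ultimately show ?thesis using RR
    by (intro exI[of _ R]) (simp add: matrix_transpose_mul)
qed

text \<open>Closeness makes \<open>transpose W0 ** W\<close> injective, so its polar decomposition
  supplies the rotation R. The aligned bound then applies with Z = W R, because rotating W leaves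
  \<open>W ** transpose W\<close> unchanged.\<close>

lemma procrustes_bound:
  fixes W W0 :: "real ^ 'r ^ 'k"
  assumes lower: "\<And>d. c * (norm d)\<^sup>2 \<le> (norm (W *v d))\<^sup>2"
    and close: "norm (W0 ** transpose W0 - W ** transpose W) < c"
  shows "\<exists>R. transpose R ** R = mat 1 \<and> R ** transpose R = mat 1 \<and>
    4 / 5 * c * (norm (W0 - W ** R))\<^sup>2 \<le> (norm (W0 ** transpose W0 - W ** transpose W))\<^sup>2"
proof -
  have c: "0 < c" using close norm_ge_zero by (rule le_less_trans[rotated])
  \<comment> \<open>For y = W z in the kernel of W0^T, H y = -W W^T y gives |W^T y|^2 \<le> |H|
    |y|^2. The lower bound on W gives c |y|^2 \<le> |W^T y|^2 on its range. As |H| < c, y and then z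
    vanish.\<close>
  have "z = 0" if z: "(transpose W0 ** W) *v z = 0" for z
  proof -
    define y where "y = W *v z"
    define H where "H = W0 ** transpose W0 - W ** transpose W"
    have "transpose W0 *v y = 0" using z by (simp add: y_def matrix_vector_mul_assoc)
    then have "H *v y = - (W *v (transpose W *v y))"
      by (simp add: H_def matrix_vector_mult_diff_rdistrib flip: matrix_vector_mul_assoc)
    then have "(norm (transpose W *v y))\<^sup>2 = - (H *v y) \<bullet> y"
      by (simp add: power2_norm_eq_inner inner_matrix_vector_transpose)
    also have "\<dots> \<le> norm (H *v y) * norm y"
      using norm_cauchy_schwarz[of "- (H *v y)" y] by simp
    also have "\<dots> \<le> norm H * norm y * norm y"
      by (intro mult_right_mono norm_matrix_vector_le) simp
    finally have 1: "(norm (transpose W *v y))\<^sup>2 \<le> norm H * (norm y)\<^sup>2" by (simp add: power2_eq_square)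
    have "(norm y)\<^sup>2 = z \<bullet> (transpose W *v y)"
      unfolding power2_norm_eq_inner y_def by (rule inner_matrix_vector_transpose)
    also have "\<dots> \<le> norm z * norm (transpose W *v y)" by (rule norm_cauchy_schwarz)
    finally have "((norm y)\<^sup>2)\<^sup>2 \<le> (norm z * norm (transpose W *v y))\<^sup>2" by (intro power_mono) auto
    then have "c * ((norm y)\<^sup>2)\<^sup>2 \<le> (c * (norm z)\<^sup>2) * (norm (transpose W *v y))\<^sup>2"
      using c by (simp add: power_mult_distrib)
    also have "\<dots> \<le> (norm y)\<^sup>2 * (norm H * (norm y)\<^sup>2)"
      using lower[of z] 1 c by (intro mult_mono) (auto simp: y_def)
    finally have "c * ((norm y)\<^sup>2)\<^sup>2 \<le> norm H * ((norm y)\<^sup>2)\<^sup>2"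
      by (simp add: power2_eq_square mult_ac)
    then have "y = 0" using close by (cases "y = 0") (auto simp: H_def)
    then have "c * (norm z)\<^sup>2 \<le> 0" using lower[of z] by (simp add: y_def)
    then show "z = 0" using c by (simp add: mult_le_0_iff)
  qed
  from polar_invertible[OF this] obtain R where R: "transpose R ** R = mat 1" "R ** transpose R = mat 1"
    and sym: "transpose (transpose W0 ** W ** R) = transpose W0 ** W ** R"
    and psd: "\<And>d. 0 \<le> ((transpose W0 ** W ** R) *v d) \<bullet> d" by blast
  have ZW: "transpose (W ** R) ** W0 = transpose W0 ** W ** R"
    using sym by (simp add: matrix_transpose_mul matrix_mul_assoc)
  have ZZ: "(W ** R) ** transpose (W ** R) = W ** transpose W"
    by (metis R(2) matrix_mul_assoc matrix_mul_rid matrix_transpose_mul)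
  have "4 / 5 * c * (norm (W0 - W ** R))\<^sup>2
      \<le> (norm (W0 ** transpose W0 - (W ** R) ** transpose (W ** R)))\<^sup>2"
  proof (rule aligned_factor_bound)
    fix d
    show "c * (norm d)\<^sup>2 \<le> (norm ((W ** R) *v d))\<^sup>2"
      using lower[of "R *v d"] by (simp add: orthogonal_matrix_norm[OF R(1)] matrix_vector_mul_assoc)
  qed (use c sym psd in \<open>simp_all add: ZW\<close>)
  then show ?thesis using R ZZ by auto
qed

section \<open>Distance to the balanced factorizations\<close>

lemma transpose_vstack_mult_vstack:
  fixes U :: "real ^ 'r ^ 'm" and V :: "real ^ 'r ^ 'n"
  shows "transpose (vstack U V) ** vstack U' V' = transpose U ** U' + transpose V ** V'"
proof -
  have "(\<Sum>i\<in>UNIV. f i) = (\<Sum>i\<in>UNIV. f (Inl i)) + (\<Sum>i\<in>UNIV. f (Inr i))" for f :: "'m + 'n \<Rightarrow> real"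
    unfolding UNIV_Plus_UNIV[symmetric] by (subst sum.Plus) (auto simp: comp_def)
  then show ?thesis
    by (simp add: vec_eq_iff matrix_matrix_mult_def transpose_def vstack_def)
qed

lemma vstack_mult: "vstack U V ** R = vstack (U ** R) (V ** R)"
  by (simp add: vec_eq_iff matrix_matrix_mult_def vstack_def split: sum.split)

text \<open>For balanced pairs the squared left-hand norm equals the square of the right-hand side
  minus 2 |G - K|^2, where G and K are the cross Gram matrices of the U and V factors.\<close>

lemma norm_balanced_gram_diff:
  fixes U U' :: "real ^ 'r ^ 'm" and V V' :: "real ^ 'r ^ 'n"
  assumes "transpose U ** U = transpose V ** V" "transpose U' ** U' = transpose V' ** V'"
  defines "W \<equiv> vstack U V" and "W' \<equiv> vstack U' V'"
  shows "norm (W ** transpose W - W' ** transpose W') \<le> 2 * norm (U ** transpose V - U' ** transpose V')"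
proof -
  define S S' G K where "S = transpose V ** V" and "S' = transpose V' ** V'"
    and "G = transpose U' ** U" and "K = transpose V' ** V"
  have sq: "(norm (x - y))\<^sup>2 = x \<bullet> x + y \<bullet> y - 2 * (x \<bullet> y)" for x y :: "'x::real_inner"
    by (simp add: power2_norm_eq_inner inner_diff_left inner_diff_right inner_commute)
  have W: "transpose W ** W = 2 *\<^sub>R S" "transpose W' ** W' = 2 *\<^sub>R S'" "transpose W' ** W = G + K"
    unfolding W_def W'_def transpose_vstack_mult_vstack assms(1,2)
    by (simp_all add: S_def S'_def G_def K_def scaleR_2)
  have "(norm (W ** transpose W - W' ** transpose W'))\<^sup>2 = 4 * (S \<bullet> S) + 4 * (S' \<bullet> S') - 2 * ((G + K) \<bullet> (G + K))"
    unfolding sq inner_mult_transpose W by simp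
  also have "\<dots> = 4 * (S \<bullet> S + S' \<bullet> S' - 2 * (G \<bullet> K)) - 2 * ((G - K) \<bullet> (G - K))"
    by (simp add: inner_diff_left inner_diff_right inner_add_left inner_add_right inner_commute algebra_simps)
  also have "S \<bullet> S + S' \<bullet> S' - 2 * (G \<bullet> K) = (norm (U ** transpose V - U' ** transpose V'))\<^sup>2"
    unfolding sq inner_mult_transpose assms(1,2) S_def S'_def G_def K_def by simp
  finally have "(norm (W ** transpose W - W' ** transpose W'))\<^sup>2
      \<le> (2 * norm (U ** transpose V - U' ** transpose V'))\<^sup>2"
    using inner_ge_zero[of "G - K"] by (simp add: power_mult_distrib)
  then show ?thesis by (rule power2_le_imp_le) simp
qed

text \<open>The Gram matrix is R^T D R with D diagonal, so R^T carries the coordinate vectors to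
  eigenvectors; \<open>inv_into\<close> puts them in the order of the weights.\<close>

lemma singular_value_scaled_columns_mult_orthogonal:
  fixes R :: "real ^ 'r ^ 'r" and a :: "nat \<Rightarrow> real ^ 'm"
  assumes e: "bij_betw e (UNIV :: 'r set) {1..CARD('r)}" and a: "orthonormal_family CARD('r) a"
    and nonneg: "\<And>i. 0 \<le> s i" and dec: "\<And>i j. 1 \<le> i \<Longrightarrow> i \<le> j \<Longrightarrow> s j \<le> s i"
    and R: "transpose R ** R = mat 1" "R ** transpose R = mat 1"
    and i: "i \<in> {1..CARD('r)}"
  shows "singular_value i (scaled_columns e s a ** R) = s i"
proof -
  define U where "U = scaled_columns e s a ** R"
  define \<rho> where "\<rho> j = transpose R *v axis (inv_into UNIV e j) 1" for j
  have inv: "e (inv_into UNIV e j) = j" if "j \<in> {1..CARD('r)}" for j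
    using bij_betw_inv_into_right[OF e that] .
  have "singular_value i U = (if i \<in> {1..CARD('r)} then sqrt (s i * s i) else 0)"
  proof (rule singular_value_eigenbasis)
    show "orthonormal_family CARD('r) \<rho>"
      unfolding orthonormal_family_def
    proof (intro ballI)
      fix j k assume j: "j \<in> {1..CARD('r)}" and k: "k \<in> {1..CARD('r)}"
      have "\<rho> j \<bullet> \<rho> k = axis (inv_into UNIV e j) 1 \<bullet> (axis (inv_into UNIV e k) 1 :: real ^ 'r)"
        unfolding \<rho>_def inner_matrix_vector_transpose
        by (simp only: matrix_vector_mul_assoc transpose_transpose R(2) matrix_vector_mul_lid)
      also have "\<dots> = (if j = k then 1 else 0)"
      proof -
        have "inv_into UNIV e j = inv_into UNIV e k \<longleftrightarrow> j = k" using inv[OF j] inv[OF k] by metis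
        then show ?thesis by (simp add: inner_axis_axis)
      qed
      finally show "\<rho> j \<bullet> \<rho> k = (if j = k then 1 else 0)" .
    qed
    show "(transpose U ** U) *v \<rho> j = (s j * s j) *\<^sub>R \<rho> j" if j: "j \<in> {1..CARD('r)}" for j
    proof -
      define D :: "real ^ 'r ^ 'r" where "D = (\<chi> k l. if k = l then s (e k) * s (e k) else 0)"
      have "transpose (scaled_columns e s a) ** scaled_columns e s a = D"
        unfolding D_def by (rule transpose_mult_scaled_columns[OF e a])
      then have "transpose U ** U = transpose R ** (D ** R)"
        by (metis U_def matrix_mul_assoc matrix_transpose_mul)
      then have "(transpose U ** U) *v \<rho> j = transpose R *v (D *v ((R ** transpose R) *v axis (inv_into UNIV e j) 1))"
        by (simp only: \<rho>_def matrix_vector_mul_assoc[symmetric])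
      also have "D *v ((R ** transpose R) *v axis (inv_into UNIV e j) 1) = (s j * s j) *\<^sub>R axis (inv_into UNIV e j) 1"
        unfolding R(2) matrix_vector_mul_lid unfolding matrix_vector_mult_basis
        by (simp add: D_def vec_eq_iff column_def axis_def inv[OF j])
      finally show ?thesis by (simp only: \<rho>_def matrix_vector_mult_scaleR)
    qed
    show "s k * s k \<le> s j * s j" if "1 \<le> j" "j \<le> k" for j k
      by (intro mult_mono dec[OF that] nonneg)
  qed
  then show ?thesis using i nonneg[of i] by (simp add: U_def)
qed

lemma Dist_le:
  assumes "(U', V') \<in> balanced_factors X"
  shows "Dist U V X \<le> norm (vstack U V - vstack U' V')"
proof -
  have "Dist U V X \<le> (case (U', V') of (U', V') \<Rightarrow> norm (vstack U V - vstack U' V'))"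
    unfolding Dist_def
    by (intro cINF_lower assms bdd_belowI2[of _ 0]) auto
  then show ?thesis by simp
qed

text \<open>The assumed member makes the set nonempty, so a lower bound of all its distances passes
  to the infimum.\<close>

lemma Dist_nonneg:
  fixes U U' :: "real ^ 'r ^ 'm" and V V' :: "real ^ 'r ^ 'n"
  assumes "(U', V') \<in> balanced_factors X"
  shows "0 \<le> Dist U V X"
  unfolding Dist_def by (rule cINF_greatest) (use assms in auto)

text \<open>A thin decomposition of X yields one balanced pair. Stacking turns the two-factor
  problem into a symmetric one, and the rotation aligning the stacks gives a balanced pair close
  enough to bound the infimum.\<close>

lemma Dist_scaled_columns_le:
  fixes X :: "real ^ 'n ^ 'm" and e :: "'r::finite \<Rightarrow> nat" and s :: "nat \<Rightarrow> real"
  assumes e: "bij_betw e UNIV {1..CARD('r)}"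
    and a: "orthonormal_family CARD('r) a" and b: "orthonormal_family CARD('r) b"
    and rank: "rank X \<le> CARD('r)" and pos: "singular_value CARD('r) X > 0"
  defines "U \<equiv> scaled_columns e s a" and "V \<equiv> scaled_columns e s b"
  assumes close: "norm (U ** transpose V - X) < singular_value CARD('r) X"
  shows "2 / 5 * singular_value CARD('r) X * (Dist U V X)\<^sup>2 \<le> (norm (U ** transpose V - X))\<^sup>2"
proof -
  let ?r = "CARD('r)"
  define \<sigma> where "\<sigma> = singular_value ?r X"
  define t where "t i = sqrt (singular_value i X)" for i
  have tt: "t i * t i = singular_value i X" for i by (simp add: t_def singular_value_nonneg)
  have r1: "1 \<le> ?r" by simp
  obtain p q where p: "orthonormal_family ?r p" and q: "orthonormal_family ?r q"
    and X: "X = (\<Sum>i=1..?r. singular_value i X *\<^sub>R outer (p i) (q i))"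
    using thin_svd_ex[OF r1 pos rank] by blast
  define U' V' where "U' = scaled_columns e t p" and "V' = scaled_columns e t q"
  have UV': "U' ** transpose V' = X"
    unfolding U'_def V'_def scaled_columns_mult_transpose[OF e] tt by (rule X[symmetric])
  define W W' where "W = vstack U V" and "W' = vstack U' V'"
  define \<delta> where "\<delta> = norm (U ** transpose V - X)"
  have gram: "norm (W ** transpose W - W' ** transpose W') \<le> 2 * \<delta>"
    unfolding W_def W'_def \<delta>_def UV'[symmetric]
    by (rule norm_balanced_gram_diff)
      (simp_all add: U_def V_def U'_def V'_def transpose_mult_scaled_columns[OF e] a b p q)
  \<comment> \<open>The Gram matrix of the stacked factors is twice the diagonal matrix of singular
    values of X, the least of which is \<open>\<sigma>\<close>.\<close>
  have lower: "2 * \<sigma> * (norm d)\<^sup>2 \<le> (norm (W' *v d))\<^sup>2" for d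
  proof -
    have "transpose W' ** W' = 2 *\<^sub>R (\<chi> k l. if k = l then t (e k) * t (e k) else 0)"
      unfolding W'_def transpose_vstack_mult_vstack U'_def V'_def
        transpose_mult_scaled_columns[OF e p] transpose_mult_scaled_columns[OF e q] by (rule scaleR_2[symmetric])
    then have comp: "((transpose W' ** W') *v d) $ k = 2 * singular_value (e k) X * d $ k" for k
      by (simp add: matrix_vector_mult_def tt if_distrib[of "\<lambda>x. x * _"] if_distrib[of "\<lambda>x. _ * x"] cong: if_cong)
    have "(norm (W' *v d))\<^sup>2 = ((transpose W' ** W') *v d) \<bullet> d"
      by (simp add: power2_norm_eq_inner inner_matrix_vector_transpose inner_commute flip: matrix_vector_mul_assoc)
    also have "\<dots> = (\<Sum>k\<in>UNIV. 2 * singular_value (e k) X * (d $ k)\<^sup>2)"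
      unfolding inner_vec_def comp by (simp add: power2_eq_square mult_ac)
    also have "\<dots> \<ge> (\<Sum>k\<in>UNIV. 2 * \<sigma> * (d $ k)\<^sup>2)"
    proof (rule sum_mono)
      fix k
      have "e k \<in> {1..?r}" using e by (auto simp: bij_betw_def)
      then show "2 * \<sigma> * (d $ k)\<^sup>2 \<le> 2 * singular_value (e k) X * (d $ k)\<^sup>2"
        unfolding \<sigma>_def by (intro mult_right_mono mult_left_mono singular_value_antimono) auto
    qed
    also have "(\<Sum>k\<in>UNIV. 2 * \<sigma> * (d $ k)\<^sup>2) = 2 * \<sigma> * (norm d)\<^sup>2"
      unfolding power2_norm_eq_inner inner_vec_def by (simp add: power2_eq_square sum_distrib_left)
    finally show ?thesis .
  qed
  have "norm (W ** transpose W - W' ** transpose W') < 2 * \<sigma>"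
    using gram close by (simp add: \<sigma>_def \<delta>_def)
  from procrustes_bound[OF lower this] obtain R
    where R: "transpose R ** R = mat 1" "R ** transpose R = mat 1"
      and bound: "4 / 5 * (2 * \<sigma>) * (norm (W - W' ** R))\<^sup>2 \<le> (norm (W ** transpose W - W' ** transpose W'))\<^sup>2"
    by blast
  \<comment> \<open>Rotating both factors by the same orthogonal R preserves the product and the
    singular values.\<close>
  have "(U' ** R, V' ** R) \<in> balanced_factors X"
  proof -
    have dec: "t j \<le> t i" if "1 \<le> i" "i \<le> j" for i j
      using that by (simp add: t_def singular_value_antimono)
    have nonneg: "0 \<le> t i" for i by (simp add: t_def singular_value_nonneg)
    have "(U' ** R) ** transpose (V' ** R) = X"
      by (metis R(2) UV' matrix_mul_assoc matrix_mul_rid matrix_transpose_mul)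
    moreover have "singular_value i (U' ** R) = t i" "singular_value i (V' ** R) = t i"
      if i: "i \<in> {1..?r}" for i
    proof -
      note * = singular_value_scaled_columns_mult_orthogonal[OF e _ nonneg _ R i]
      show "singular_value i (U' ** R) = t i" unfolding U'_def by (rule *[OF p]) (rule dec)
      show "singular_value i (V' ** R) = t i" unfolding V'_def by (rule *[OF q]) (rule dec)
    qed
    ultimately show ?thesis by (simp add: balanced_factors_def t_def)
  qed
  note Dist_nonneg[OF this] and Dist_le[OF this]
  then have "0 \<le> Dist U V X" and D: "Dist U V X \<le> norm (W - W' ** R)"
    unfolding W_def W'_def vstack_mult by blast+
  with D have "(Dist U V X)\<^sup>2 \<le> (norm (W - W' ** R))\<^sup>2" by (intro power_mono)
  \<comment> \<open>The factor 8/5 is 4/5 times the lower bound 2 of the stack; dividing by the 4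
    from (2 \<delta>)^2 leaves 2/5.\<close>
  then have "8 / 5 * \<sigma> * (Dist U V X)\<^sup>2 \<le> 8 / 5 * \<sigma> * (norm (W - W' ** R))\<^sup>2"
    using pos by (intro mult_left_mono) (auto simp: \<sigma>_def)
  also have "\<dots> \<le> (norm (W ** transpose W - W' ** transpose W'))\<^sup>2" using bound by simp
  also have "\<dots> \<le> (2 * \<delta>)\<^sup>2" using gram by (intro power_mono) auto
  finally show ?thesis by (simp add: \<sigma>_def \<delta>_def power_mult_distrib)
qed

section \<open>From the truncated decomposition to the bound on the initial distance\<close>

lemma mult_diag_sqrt_eq_scaled_columns:
  assumes "\<And>k. column k A = a (e k)" "S = (\<chi> k l. if k = l then s (e k) else 0)"
  shows "A ** diag_sqrt S = scaled_columns e (\<lambda>i. sqrt (s i)) a"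
proof -
  have "A $ i $ k = a (e k) $ i" for i k using assms(1)[of k, symmetric] by (simp add: column_def)
  then show ?thesis
    by (simp add: vec_eq_iff matrix_matrix_mult_def diag_sqrt_def scaled_columns_def assms(2)
        if_distrib[of "\<lambda>x. _ * x"] mult.commute cong: if_cong)
qed

theorem corollary5p2:
  fixes f :: "real ^ 'n ^ 'm \<Rightarrow> real"
    and g :: "real ^ 'r ^ 'r \<Rightarrow> real"
    and L \<mu> Lg \<mu>g \<kappa> :: real
    and Xstar Xr :: "real ^ 'n ^ 'm"
    and A0 U0 :: "real ^ 'r ^ 'm"
    and \<Sigma>0 :: "real ^ 'r ^ 'r"
    and B0 V0 :: "real ^ 'r ^ 'n"
  assumes "smooth L f" and "strongly_convex \<mu> f" and "0 < \<mu>"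
    and "smooth Lg g" and "strongly_convex \<mu>g g" and "0 < \<mu>g" and "\<mu>g \<le> Lg"
    and "is_arg_min f (\<lambda>_. True) Xstar"
    and "CARD('r) \<le> rank Xstar"
    and "best_rank_approx CARD('r) Xstar Xr"
    and "\<kappa> = max L Lg / min \<mu> \<mu>g"
    and "norm (Xstar - Xr) \<le> singular_value CARD('r) Xstar / (100 * sqrt \<kappa>)"
    and "\<kappa> \<le> 1 + (singular_value CARD('r) Xr)\<^sup>2 / (4608 * (norm Xr)\<^sup>2)"
    and "is_truncated_svd (- (1 / L) *\<^sub>R gradient f 0) A0 \<Sigma>0 B0"
    and "U0 = A0 ** diag_sqrt \<Sigma>0"
    and "V0 = B0 ** diag_sqrt \<Sigma>0"
  shows "Dist U0 V0 Xr \<le> sqrt 2 * sqrt (singular_value CARD('r) Xr) / (10 * sqrt \<kappa>)"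
proof -
  let ?r = "CARD('r)"
  define s where "s = singular_value ?r Xr"
  define \<tau> where "\<tau> = singular_value ?r Xstar"
  define M where "M = - (1 / L) *\<^sub>R gradient f 0"
  have r1: "1 \<le> ?r" by simp
  have "\<mu> \<le> L" using assms(1,2) by (rule strongly_convex_le_smooth)
  then have L: "0 < L" using \<open>0 < \<mu>\<close> by simp
  have \<kappa>L: "L / \<mu> \<le> \<kappa>"
    unfolding \<open>\<kappa> = _\<close> using L \<open>0 < \<mu>\<close> \<open>0 < \<mu>g\<close> by (intro frac_le) auto
  moreover have "1 \<le> L / \<mu>" using \<open>\<mu> \<le> L\<close> \<open>0 < \<mu>\<close> by simp
  ultimately have \<kappa>1: "1 \<le> \<kappa>" by simp
  have \<tau>: "0 < \<tau>"
  proof (rule ccontr)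
    assume "\<not> 0 < \<tau>"
    then have "singular_value (Suc (?r - 1)) Xstar = 0"
      using singular_value_nonneg[of ?r Xstar] by (simp add: \<tau>_def)
    then have "rank Xstar \<le> ?r - 1" by (rule rank_le_of_singular_value_eq_0)
    then show False using assms(9) r1 by linarith
  qed
  \<comment> \<open>The hypothesis measures the error against the singular value of
    \<open>Xstar\<close>, while later bounds use that of \<open>Xr\<close>; the perturbation
    inequality turns 1/100 into 1/99.\<close>
  define \<epsilon> where "\<epsilon> = norm (Xstar - Xr)"
  have "\<epsilon> \<le> \<tau> / (100 * sqrt \<kappa>)" using assms(12) by (simp add: \<tau>_def \<epsilon>_def)
  also have "\<dots> \<le> \<tau> / 100" using \<kappa>1 \<tau> by (intro divide_left_mono) auto
  finally have "\<epsilon> \<le> \<tau> / 100" .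
  moreover have "\<tau> \<le> s + \<epsilon>"
    unfolding \<tau>_def s_def \<epsilon>_def by (rule singular_value_perturbation[OF r1])
  ultimately have \<epsilon>: "\<epsilon> \<le> s / 99" and s: "0 < s" using \<tau> by linarith+
  have rank: "rank Xr \<le> ?r" using assms(10) by (simp add: best_rank_approx_def is_arg_min_def)
  have sX: "s \<le> norm Xr" unfolding s_def by (rule singular_value_le_norm)
  \<comment> \<open>The constant comes from (100/99)^2 / 4608 \<le> 1/67^2, where 100/99 bounds the
    ratio of the norms of \<open>Xstar\<close> and \<open>Xr\<close>.\<close>
  have M: "norm (M - Xstar) \<le> s / 67"
  proof -
    have "f Xstar \<le> f Y" for Y using assms(8) by (simp add: is_arg_min_linorder)
    from gradient_step_contraction[OF assms(1,2) L this, of 0]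
    have "(norm (M - Xstar))\<^sup>2 \<le> (1 - \<mu> / L) * (norm Xstar)\<^sup>2" by (simp add: M_def)
    also have "\<dots> \<le> s\<^sup>2 / (4608 * (norm Xr)\<^sup>2) * (100 / 99 * norm Xr)\<^sup>2"
    proof (rule mult_mono)
      \<comment> \<open>The sum of a positive number and its reciprocal is at least 2, so the
        contraction factor is at most \<kappa> - 1.\<close>
      have "1 - \<mu> / L \<le> L / \<mu> - 1"
      proof -
        have "0 \<le> (L - \<mu>)\<^sup>2 / (L * \<mu>)" using L \<open>0 < \<mu>\<close> by simp
        also have "\<dots> = L / \<mu> + \<mu> / L - 2" using L \<open>0 < \<mu>\<close> by (simp add: field_simps power2_eq_square)
        finally show ?thesis by simp
      qed
      then show "1 - \<mu> / L \<le> s\<^sup>2 / (4608 * (norm Xr)\<^sup>2)" using \<kappa>L assms(13) by (simp add: s_def)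
      have "norm Xstar \<le> norm Xr + \<epsilon>"
        unfolding \<epsilon>_def by (rule norm_triangle_sub)
      then show "(norm Xstar)\<^sup>2 \<le> (100 / 99 * norm Xr)\<^sup>2" using \<epsilon> sX by (intro power_mono) auto
    qed auto
    also have "\<dots> = s\<^sup>2 * ((100 / 99)\<^sup>2 / 4608)" proof -
      have "Xr \<noteq> 0" using s sX by auto
      then show ?thesis by (simp add: field_simps)
    qed
    also have "\<dots> \<le> s\<^sup>2 * (1 / 67)\<^sup>2" by (intro mult_left_mono) (auto simp: power2_eq_square)
    finally have "(norm (M - Xstar))\<^sup>2 \<le> (s / 67)\<^sup>2" by (simp add: power_divide)
    then show ?thesis by (rule power2_le_imp_le) (use s in simp)
  qed
  \<comment> \<open>Here 1/67 + 1/99 \<le> 1/39.\<close>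
  have MXr: "norm (M - Xr) \<le> s / 39"
    using norm_triangle_ineq[of "M - Xstar" "Xstar - Xr"] M \<epsilon> s by (simp add: \<epsilon>_def)
  obtain a b and e :: "'r \<Rightarrow> nat" where rmn: "?r \<le> min CARD('m) CARD('n)" and svd: "is_svd M a b"
    and e: "bij_betw e UNIV {1..?r}" and A0: "\<And>k. column k A0 = a (e k)" and B0: "\<And>k. column k B0 = b (e k)"
    and \<Sigma>0: "\<Sigma>0 = (\<chi> k l. if k = l then singular_value (e k) M else 0)"
    using assms(14) unfolding is_truncated_svd_def M_def by blast
  have a: "orthonormal_family ?r a" and b: "orthonormal_family ?r b"
    using svd orthonormal_family_mono[OF _ rmn] by (auto simp: is_svd_def Let_def)
  define t where "t i = sqrt (singular_value i M)" for i
  have U0: "U0 = scaled_columns e t a" and V0: "V0 = scaled_columns e t b"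
    unfolding t_def[abs_def] assms(15,16)
    using mult_diag_sqrt_eq_scaled_columns[OF A0 \<Sigma>0] mult_diag_sqrt_eq_scaled_columns[OF B0 \<Sigma>0] by auto
  define \<delta> where "\<delta> = norm (U0 ** transpose V0 - Xr)"
  have "U0 ** transpose V0 = (\<Sum>i=1..?r. singular_value i M *\<^sub>R outer (a i) (b i))"
    unfolding U0 V0 scaled_columns_mult_transpose[OF e] by (simp add: t_def singular_value_nonneg)
  then have "norm (M - U0 ** transpose V0) \<le> norm (M - Xr)"
    using eckart_young[OF svd r1 rmn rank] by simp
  \<comment> \<open>\<open>Xr\<close> competes in the best approximation of M, so the truncation is
    within s/39 of M; a second s/39 leads from M to \<open>Xr\<close>.\<close>
  then have \<delta>: "\<delta> \<le> 2 * s / 39"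
    using norm_triangle_ineq[of "U0 ** transpose V0 - M" "M - Xr"] MXr
    by (simp add: \<delta>_def norm_minus_commute)
  have "2 / 5 * s * (Dist U0 V0 Xr)\<^sup>2 \<le> \<delta>\<^sup>2"
    using Dist_scaled_columns_le[OF e a b rank, of t] s \<delta> unfolding s_def \<delta>_def U0 V0 by simp
  also have "\<dots> \<le> (2 * s / 39)\<^sup>2" using \<delta> by (intro power_mono) (auto simp: \<delta>_def)
  finally have "(2 / 5 * s) * (Dist U0 V0 Xr)\<^sup>2 \<le> (2 / 5 * s) * (10 / 1521 * s)"
    by (simp add: power2_eq_square)
  then have "(Dist U0 V0 Xr)\<^sup>2 \<le> 10 / 1521 * s" using s by (subst (asm) mult_le_cancel_left_pos) auto
  \<comment> \<open>As s is at most the norm of \<open>Xr\<close>, the hypothesis forces \<kappa>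
    \<le> 2, and then 10/1521 \<le> 1/100 \<le> 2/(100 \<kappa>).\<close>
  also have "\<dots> \<le> 2 * s / (100 * \<kappa>)"
  proof -
    have "s\<^sup>2 / (4608 * (norm Xr)\<^sup>2) \<le> 1"
      proof -
      have "0 < norm Xr" using s sX by linarith
      moreover have "s\<^sup>2 \<le> (norm Xr)\<^sup>2" using s sX by (intro power_mono) auto
      ultimately have "s\<^sup>2 \<le> 4608 * (norm Xr)\<^sup>2" "0 < 4608 * (norm Xr)\<^sup>2"
        using zero_less_power[of "norm Xr" 2] by linarith+
      then show ?thesis by (subst divide_le_eq_1_pos)
    qed
    then have "\<kappa> \<le> 2" using assms(13) by (simp add: s_def)
    then show ?thesis using \<kappa>1 s by (simp add: field_simps)
  qed
  also have "\<dots> = (sqrt 2 * sqrt s / (10 * sqrt \<kappa>))\<^sup>2"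
    using s \<kappa>1 by (simp add: power_divide power_mult_distrib)
  finally show ?thesis unfolding s_def[symmetric] by (rule power2_le_imp_le) (use s \<kappa>1 in simp)
qed

end
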